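(* Let $C\subset\mathbb{P}^2$ be a maximal nodal curve of degree $d\geq 2$ over $\mathbb{C}$. Then $C$ is a maximal Tjurina curve of type $(d,d-1)$.
   Context: A maximal nodal curve of degree $d$ is an irreducible, rational, nodal plane curve of degree $d$; it has exactly $(d-1)(d-2)/2$ nodes (ordinary double points) and no other singularities. Let $S=\mathbb{C}[x,y,z]$ with its standard grading, and let $C:f=0$ be a reduced curve of degree $d$ in the complex projective plane $\mathbb{P}^2$, with $f\in S$ homogeneous of degree $d$ and partial derivatives $f_x,f_y,f_z$. Let $$AR(f)=\{(a,b,c)\in S^3 : af_x+bf_y+cf_z=0\},$$ graded so that $(a,b,c)$ with $a,b,c$ homogeneous of degree $k$ has degree $k$, and let $mdr(f)$ be the minimal degree of a non-zero homogeneous element of $AR(f)$. The global Tjurina number $\tau(C)$ is the degree of the Jacobian ideal $J_f=(f_x,f_y,f_z)$ (i.e. $\dim_{\mathbb{C}}(S/J_f)_k$ for large $k$), equivalently the sum of the Tjurina numbers of all singular points of $C$. For integers $d,r$ with $d/2\leq r\leq d-1$ set $$\tau(d,r)_{max}=(d-1)(d-r-1)+r^2-\binom{2r-d+2}{2}.$$ A reduced plane curve $C:f=0$ is called a maximal Tjurina curve of type $(d,r)$ if $\deg f=d$, $mdr(f)=r$ and $\tau(C)=\tau(d,r)_{max}$. *)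

theory Defs
  imports Complex_Main "HOL-Library.Poly_Mapping" "HOL-Library.Numeral_Type"
    "HOL-Computational_Algebra.Squarefree"
begin

text \<open>
  A polynomial in variables indexed by \<open>'v\<close> maps each exponent vector \<open>'v \<Rightarrow>\<^sub>0 nat\<close>
  to its coefficient. With the index types \<open>2 = {0,1}\<close> and \<open>3 = {0,1,2}\<close> of
  Numeral_Type, \<open>3 cpoly\<close> is \<open>S = \<complex>[x,y,z]\<close> and \<open>2 cpoly\<close> is \<open>\<complex>[s,t]\<close>, the
  homogeneous coordinate ring of the projective line.
\<close>

type_synonym 'v cpoly = "('v \<Rightarrow>\<^sub>0 nat) \<Rightarrow>\<^sub>0 complex"

definition cst :: "complex \<Rightarrow> 'v cpoly" where
  "cst c = Poly_Mapping.single 0 c"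

definition X :: "'v \<Rightarrow> 'v cpoly" where
  "X i = Poly_Mapping.single (Poly_Mapping.single i 1) 1"

definition mdeg :: "('v::finite \<Rightarrow>\<^sub>0 nat) \<Rightarrow> nat" where
  "mdeg m = (\<Sum>i\<in>UNIV. Poly_Mapping.lookup m i)"

text \<open>The zero polynomial is homogeneous of every degree.\<close>

definition homogeneous :: "nat \<Rightarrow> 'v::finite cpoly \<Rightarrow> bool" where
  "homogeneous k p \<longleftrightarrow> (\<forall>m\<in>Poly_Mapping.keys p. mdeg m = k)"

definition hcomp :: "nat \<Rightarrow> 'v::finite cpoly \<Rightarrow> 'v cpoly" where
  "hcomp k p = (\<Sum>m\<in>{m \<in> Poly_Mapping.keys p. mdeg m = k}.
     Poly_Mapping.single m (Poly_Mapping.lookup p m))"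

text \<open>
  The subtraction of exponents truncates, but only in terms whose coefficient is \<open>0\<close>.
\<close>

definition pdiff :: "'v \<Rightarrow> 'v cpoly \<Rightarrow> 'v cpoly" where
  "pdiff i p = (\<Sum>m\<in>Poly_Mapping.keys p.
     Poly_Mapping.single (m - Poly_Mapping.single i 1)
       (of_nat (Poly_Mapping.lookup m i) * Poly_Mapping.lookup p m))"

definition eval :: "('v::finite \<Rightarrow> complex) \<Rightarrow> 'v cpoly \<Rightarrow> complex" where
  "eval v p = (\<Sum>m\<in>Poly_Mapping.keys p.
     Poly_Mapping.lookup p m * (\<Prod>i\<in>UNIV. v i ^ Poly_Mapping.lookup m i))"

definition psubst :: "('v::finite \<Rightarrow> 'w cpoly) \<Rightarrow> 'v cpoly \<Rightarrow> 'w cpoly" where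
  "psubst v p = (\<Sum>m\<in>Poly_Mapping.keys p.
     cst (Poly_Mapping.lookup p m) * (\<Prod>i\<in>UNIV. v i ^ Poly_Mapping.lookup m i))"

interpretation cpoly: vector_space "\<lambda>c (p :: 'v cpoly). cst c * p"
  by unfold_locales
    (simp_all add: cst_def algebra_simps single_add single_one mult_single
      flip: mult.assoc)


text \<open>
  Points of the projective plane are given by nonzero vectors of homogeneous coordinates.
\<close>

definition singular_point :: "3 cpoly \<Rightarrow> (3 \<Rightarrow> complex) \<Rightarrow> bool" where
  "singular_point f p \<longleftrightarrow>
     (\<exists>i. p i \<noteq> 0) \<and> eval p f = 0 \<and> (\<forall>i. eval p (pdiff i f) = 0)"

text \<open>
  Equation of the curve in the affine chart \<open>x\<^sub>i = p\<^sub>i\<close> (where \<open>p\<^sub>i \<noteq> 0\<close>), with the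
  other two coordinates translated so that \<open>p\<close> is the origin. The result does not
  involve the variable \<open>X i\<close>.
\<close>

definition local_equation :: "3 \<Rightarrow> (3 \<Rightarrow> complex) \<Rightarrow> 3 cpoly \<Rightarrow> 3 cpoly" where
  "local_equation i p f = psubst (\<lambda>j. if j = i then cst (p j) else cst (p j) + X j) f"

text \<open>
  Ordinary double point: multiplicity two, and the tangent cone consists of two distinct
  lines. This does not depend on the chart.
\<close>

definition node :: "3 cpoly \<Rightarrow> (3 \<Rightarrow> complex) \<Rightarrow> bool" where
  "node f p \<longleftrightarrow> (\<exists>i. p i \<noteq> 0 \<and>
     hcomp 0 (local_equation i p f) = 0 \<and> hcomp 1 (local_equation i p f) = 0 \<and>
     (\<exists>L1 L2. homogeneous 1 L1 \<and> homogeneous 1 L2 \<and>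
        (\<forall>a b. cst a * L1 + cst b * L2 = 0 \<longrightarrow> a = 0 \<and> b = 0) \<and>
        hcomp 2 (local_equation i p f) = L1 * L2))"

definition nodal :: "3 cpoly \<Rightarrow> bool" where
  "nodal f \<longleftrightarrow> (\<forall>p. singular_point f p \<longrightarrow> node f p)"

text \<open>
  For irreducible \<open>f\<close>: the curve \<open>f = 0\<close> is birational to the projective line. The tuple
  \<open>\<phi>\<close> is a rational map from the line to the curve, \<open>\<psi>\<close> one from the curve to the line;
  the condition on \<open>psubst \<phi> (\<psi> j)\<close> says that \<open>\<psi> \<circ> \<phi>\<close> is defined and equal to the
  identity, and the last one that \<open>\<phi> \<circ> \<psi>\<close> is defined and equal to the identity
  on the curve, where a form vanishes on the curve iff \<open>f\<close> divides it.
\<close>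

definition rational_curve :: "3 cpoly \<Rightarrow> bool" where
  "rational_curve f \<longleftrightarrow> (\<exists>(\<phi> :: 3 \<Rightarrow> 2 cpoly) (\<psi> :: 2 \<Rightarrow> 3 cpoly) m e.
     (\<forall>i. homogeneous m (\<phi> i)) \<and> (\<exists>i. \<phi> i \<noteq> 0) \<and> psubst \<phi> f = 0 \<and>
     (\<forall>j. homogeneous e (\<psi> j)) \<and> (\<exists>j. \<not> f dvd \<psi> j) \<and>
     (\<exists>j. psubst \<phi> (\<psi> j) \<noteq> 0) \<and>
     (\<forall>j k. X j * psubst \<phi> (\<psi> k) = X k * psubst \<phi> (\<psi> j)) \<and>
     (\<exists>i. \<not> f dvd psubst \<psi> (\<phi> i)) \<and>
     (\<forall>i k. f dvd X i * psubst \<psi> (\<phi> k) - X k * psubst \<psi> (\<phi> i)))"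

definition maximal_nodal_curve :: "nat \<Rightarrow> 3 cpoly \<Rightarrow> bool" where
  "maximal_nodal_curve d f \<longleftrightarrow>
     homogeneous d f \<and> irreducible f \<and> rational_curve f \<and> nodal f"


definition AR :: "3 cpoly \<Rightarrow> (3 \<Rightarrow> 3 cpoly) set" where
  "AR f = {a. (\<Sum>i\<in>UNIV. a i * pdiff i f) = 0}"

definition mdr :: "3 cpoly \<Rightarrow> nat" where
  "mdr f = (LEAST k. \<exists>a\<in>AR f. (\<forall>i. homogeneous k (a i)) \<and> (\<exists>i. a i \<noteq> 0))"

definition jacobian_ideal :: "3 cpoly \<Rightarrow> 3 cpoly set" where
  "jacobian_ideal f = {\<Sum>i\<in>UNIV. a i * pdiff i f | a. True}"

text \<open>
  The dimension of \<open>(S/J\<^sub>f)\<^sub>k = S\<^sub>k / (J\<^sub>f \<inter> S\<^sub>k)\<close>; both spaces are finite-dimensional.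
\<close>

definition milnor_hilbert :: "3 cpoly \<Rightarrow> nat \<Rightarrow> nat" where
  "milnor_hilbert f k = cpoly.dim {g :: 3 cpoly. homogeneous k g}
     - cpoly.dim (jacobian_ideal f \<inter> {g. homogeneous k g})"

definition global_tjurina :: "3 cpoly \<Rightarrow> nat" where
  "global_tjurina f = (THE t. \<forall>\<^sub>F k in sequentially. milnor_hilbert f k = t)"

definition tau_max :: "nat \<Rightarrow> nat \<Rightarrow> int" where
  "tau_max d r = (int d - 1) * (int d - int r - 1) + int r ^ 2
     - int ((2 * r + 2 - d) choose 2)"

text \<open>
  The first three conditions say that \<open>f = 0\<close> is a reduced curve of degree \<open>d\<close>
  (\<open>squarefree\<close> excludes \<open>f = 0\<close>), the next two that \<open>d/2 \<le> r \<le> d - 1\<close>.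
\<close>

definition maximal_tjurina_curve :: "nat \<Rightarrow> nat \<Rightarrow> 3 cpoly \<Rightarrow> bool" where
  "maximal_tjurina_curve d r f \<longleftrightarrow>
     d \<ge> 1 \<and> homogeneous d f \<and> squarefree f \<and> d \<le> 2 * r \<and> r + 1 \<le> d \<and>
     mdr f = r \<and> int (global_tjurina f) = tau_max d r"

end

theory Submission
  imports Defs "HOL-Computational_Algebra.Computational_Algebra"
    "HOL-Computational_Algebra.Field_as_Ring" "HOL-Library.Function_Algebras"
begin

text \<open>Polynomials in one variable stand for forms on the parameter line. The point at infinity
  is therefore moved to a point where some partial derivative of \<open>f\<close> does not vanish
  along the curve; that partial then has full degree, and every common zero of the gradient is an
  affine root. That the parametrization has degree \<open>d\<close> is not part of the definition of
  rationality. It comes from growth rates: the pullbacks of forms span a space whose dimension grows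
  with slope \<open>d\<close> in the degree, while the inverse map \<psi> puts a fixed multiple of
  all polynomials of the right degree into that space. The nodes are never counted. The number
  (d-1)(d-2)/2 appears because two inequalities meet. Syzygies are bounded by the choices of \<rho>
  plus \<open>f\<close> times the relations among the three variables. The content of the gradient
  has degree at least d(d-1) - (2d-2), where d(d-1) is the degree of the gradient along the curve
  and 2d-2 bounds the degree of the cross product of \<open>u\<close> with its derivative.\<close>

text \<open>
  Let \<open>u\<close> be a parametrization of the curve by coprime polynomials of degree \<open>d\<close>. A syzygy
  \<open>a\<close> of degree \<open>k\<close> is tangent to the curve, so along the curve the cross product of the
  position vector with \<open>a\<close> is a rational multiple \<open>\<rho>\<close> of the gradient of \<open>f\<close>. At a node
  the Hessian is nondegenerate transversally, so \<open>a\<close> is proportional to the position vector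
  there, and this zero of the cross product cancels the zero of the gradient on each branch.
  Hence \<open>\<rho>\<close> is a form of degree \<open>d (k + 2 - d)\<close> on the line, and forms of degree less than
  \<open>d\<close> that vanish on the curve are \<open>0\<close>. For \<open>k \<le> d - 2\<close> this leaves only the trivial
  syzygy. For large \<open>k\<close> it bounds the dimension of the syzygies of degree \<open>k\<close>, hence \<open>\<tau>\<close>,
  from above. The lower bound for \<open>\<tau>\<close> holds because the Jacobian ideal pulls back into the
  multiples of the content of the gradient, which has degree at least \<open>(d - 1) (d - 2)\<close>: the
  primitive part of the gradient divides \<open>u \<times> u'\<close>.
\<close>

section \<open>Substitution in polynomials\<close>

locale comm_ring_hom =
  fixes h :: "'a::comm_ring_1 \<Rightarrow> 'b::comm_ring_1"
  assumes hom_one [simp]: "h 1 = 1"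
    and hom_add [simp]: "h (a + b) = h a + h b"
    and hom_mult [simp]: "h (a * b) = h a * h b"
begin

lemma hom_zero [simp]: "h 0 = 0"
  using hom_add[of 0 0] by (simp del: hom_add)

lemma hom_uminus [simp]: "h (- a) = - h a"
  using hom_add[of "- a" a] by (simp add: eq_neg_iff_add_eq_0 del: hom_add)

lemma hom_diff [simp]: "h (a - b) = h a - h b"
  using hom_add[of a "- b"] by (simp del: hom_add)

lemma hom_sum: "h (sum g A) = (\<Sum>x\<in>A. h (g x))"
  by (induction A rule: infinite_finite_induct) auto

lemma hom_power: "h (a ^ n) = h a ^ n"
  by (induction n) auto

lemma hom_of_nat: "h (of_nat n) = of_nat n"
  by (induction n) auto

end

lemma cst_hom: "comm_ring_hom (cst :: complex \<Rightarrow> 'v cpoly)"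
  by unfold_locales (simp_all add: cst_def single_add mult_single single_one)

lemma const_poly_hom: "comm_ring_hom (\<lambda>c :: complex. [:c:])"
  by unfold_locales auto

lemma id_hom: "comm_ring_hom (id :: complex \<Rightarrow> complex)"
  by unfold_locales auto

lemma cst_0 [simp]: "cst 0 = 0" and cst_1 [simp]: "cst 1 = 1"
  and cst_add: "cst (a + b) = cst a + cst b" and cst_mult: "cst (a * b) = cst a * cst b"
  and cst_of_nat: "cst (of_nat n) = of_nat n"
  using comm_ring_hom.hom_zero[OF cst_hom] comm_ring_hom.hom_one[OF cst_hom]
    comm_ring_hom.hom_add[OF cst_hom] comm_ring_hom.hom_mult[OF cst_hom]
    comm_ring_hom.hom_of_nat[OF cst_hom] by auto

lemma cst_eq_0_iff [simp]: "cst a = 0 \<longleftrightarrow> a = 0"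
  by (metis cst_def lookup_single_eq lookup_zero single_zero)

text \<open>One substitution for all coefficient maps: \<open>cst\<close> gives
  \<open>psubst\<close>, \<open>id\<close> gives \<open>eval\<close>, and constant polynomials in
  one variable give the restriction of a form to a parametrized curve.\<close>

definition insertion :: "(complex \<Rightarrow> 'a::comm_ring_1) \<Rightarrow> ('v::finite \<Rightarrow> 'a) \<Rightarrow> 'v cpoly \<Rightarrow> 'a" where
  "insertion c v p = (\<Sum>m\<in>Poly_Mapping.keys p.
     c (Poly_Mapping.lookup p m) * (\<Prod>i\<in>UNIV. v i ^ Poly_Mapping.lookup m i))"

lemma psubst_eq_insertion: "psubst v p = insertion cst v p"
  by (simp add: psubst_def insertion_def)

lemma eval_eq_insertion: "eval v p = insertion id v p"
  by (simp add: eval_def insertion_def)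

lemma cpoly_eq_sum_single:
  "p = (\<Sum>m\<in>Poly_Mapping.keys p. Poly_Mapping.single m (Poly_Mapping.lookup p m))"
  by (rule poly_mapping_eqI)
    (simp add: lookup_sum lookup_single when_def in_keys_iff sum.delta)

lemma cpoly_single_induct:
  assumes "P 0" "\<And>p q. P p \<Longrightarrow> P q \<Longrightarrow> P (p + q)" "\<And>m a. P (Poly_Mapping.single m a)"
  shows "P (p :: 'v cpoly)"
proof -
  have "P (\<Sum>m\<in>A. Poly_Mapping.single m (Poly_Mapping.lookup p m))" if "finite A" for A
    using that by induction (auto intro: assms)
  then show ?thesis
    by (subst cpoly_eq_sum_single) simp
qed

lemma X_power: "X i ^ n = (Poly_Mapping.single (Poly_Mapping.single i n) 1 :: 'v cpoly)"
  by (induction n) (simp_all add: X_def single_one mult_single flip: single_add)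

lemma prod_single: "(\<Prod>i\<in>A. Poly_Mapping.single (g i) 1 :: 'v cpoly) = Poly_Mapping.single (\<Sum>i\<in>A. g i) 1"
  by (induction A rule: infinite_finite_induct) (auto simp: single_one mult_single)

lemma single_eq_monomial:
  "(Poly_Mapping.single m a :: 'v::finite cpoly) = cst a * (\<Prod>i\<in>UNIV. X i ^ Poly_Mapping.lookup m i)"
proof -
  have "(\<Sum>i\<in>UNIV. Poly_Mapping.single i (Poly_Mapping.lookup m i)) = m"
    by (rule poly_mapping_eqI) (simp add: lookup_sum lookup_single when_def sum.delta)
  then show ?thesis
    by (simp add: X_power prod_single cst_def mult_single)
qed

text \<open>Constants and variables generate the ring, so the homomorphism, chain and Taylor rules
  below need only be checked on generators and carried through sums and products.\<close>

lemma cpoly_induct [case_names cst X add mult]: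
  assumes cst: "\<And>a. P (cst a)" and X: "\<And>i. P (X i)"
    and add: "\<And>p q. P p \<Longrightarrow> P q \<Longrightarrow> P (p + q)" and mult: "\<And>p q. P p \<Longrightarrow> P q \<Longrightarrow> P (p * q)"
  shows "P (p :: 'v::finite cpoly)"
proof (induction p rule: cpoly_single_induct)
  case 1
  then show ?case using cst[of 0] by simp
next
  case (3 m a)
  have pow: "P (q ^ n)" if "P q" for q n
    by (induction n) (use that mult cst[of 1] in auto)
  have "P (\<Prod>i\<in>A. X i ^ Poly_Mapping.lookup m i)" for A
    by (induction A rule: infinite_finite_induct) (use mult cst[of 1] pow X in auto)
  then show ?case
    using mult cst by (simp add: single_eq_monomial)
qed (rule add)

lemma insertion_superset:
  assumes "finite A" "Poly_Mapping.keys p \<subseteq> A" "c 0 = 0"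
  shows "insertion c v p = (\<Sum>m\<in>A. c (Poly_Mapping.lookup p m) * (\<Prod>i\<in>UNIV. v i ^ Poly_Mapping.lookup m i))"
  unfolding insertion_def
  by (rule sum.mono_neutral_left) (use assms in \<open>auto simp: in_keys_iff\<close>)

context
  fixes c :: "complex \<Rightarrow> 'a::comm_ring_1"
  assumes c: "comm_ring_hom c"
begin

interpretation c: comm_ring_hom c by (rule c)

lemma insertion_single:
  "insertion c v (Poly_Mapping.single m a) = c a * (\<Prod>i\<in>UNIV. v i ^ Poly_Mapping.lookup m i)"
  by (auto simp: insertion_def)

lemma insertion_add: "insertion c v (p + q) = insertion c v p + insertion c v q"
proof -
  let ?A = "Poly_Mapping.keys p \<union> Poly_Mapping.keys q"
  have "Poly_Mapping.keys (p + q) \<subseteq> ?A"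
    by (rule keys_add)
  then show ?thesis
    by (simp add: insertion_superset[of ?A] lookup_add sum.distrib algebra_simps)
qed

lemma insertion_mult: "insertion c v (p * q) = insertion c v p * insertion c v q"
proof (induction p rule: cpoly_single_induct)
  case (3 m a)
  show ?case
  proof (induction q rule: cpoly_single_induct)
    case (3 n b)
    show ?case
      by (simp add: mult_single insertion_single lookup_add power_add prod.distrib mult_ac)
  qed (simp_all add: insertion_add algebra_simps insertion_def[of _ _ 0])
qed (simp_all add: insertion_add algebra_simps insertion_def[of _ _ 0])

lemma insertion_cst [simp]: "insertion c v (cst a) = c a"
  by (simp add: cst_def insertion_single)

lemma insertion_hom: "comm_ring_hom (insertion c v)"
proof
  show "insertion c v 1 = 1"
    using insertion_cst[of v 1] by simp
qed (simp_all add: insertion_add insertion_mult)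

lemma insertion_X [simp]: "insertion c v (X i) = v i"
proof -
  have "(\<Prod>j\<in>UNIV. v j ^ Poly_Mapping.lookup (Poly_Mapping.single i (1::nat)) j) = (\<Prod>j\<in>UNIV. if j = i then v j else 1)"
    by (rule prod.cong) (auto simp: lookup_single when_def)
  then show ?thesis
    by (simp add: X_def insertion_single prod.delta)
qed

end

lemmas insertion_simps = comm_ring_hom.hom_one[OF insertion_hom]
  comm_ring_hom.hom_zero[OF insertion_hom] comm_ring_hom.hom_add[OF insertion_hom]
  comm_ring_hom.hom_mult[OF insertion_hom] comm_ring_hom.hom_diff[OF insertion_hom]
  comm_ring_hom.hom_uminus[OF insertion_hom] comm_ring_hom.hom_sum[OF insertion_hom]
  comm_ring_hom.hom_power[OF insertion_hom]

lemma hom_insertion: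
  assumes "comm_ring_hom c" "comm_ring_hom H"
  shows "H (insertion c v p) = insertion (\<lambda>a. H (c a)) (\<lambda>i. H (v i)) p"
proof -
  interpret c: comm_ring_hom c by fact
  interpret H: comm_ring_hom H by fact
  have Hc: "comm_ring_hom (\<lambda>a. H (c a))"
    by unfold_locales auto
  show ?thesis
    by (induction p rule: cpoly_induct)
      (simp_all add: insertion_add[OF assms(1)] insertion_add[OF Hc] insertion_mult[OF assms(1)]
        insertion_mult[OF Hc] insertion_cst[OF assms(1)] insertion_cst[OF Hc]
        insertion_X[OF assms(1)] insertion_X[OF Hc])
qed

lemma insertion_psubst:
  assumes "comm_ring_hom c"
  shows "insertion c u (psubst v p) = insertion c (\<lambda>i. insertion c u (v i)) p"
  unfolding psubst_eq_insertion
  by (subst hom_insertion[OF cst_hom insertion_hom[OF assms]]) (simp add: insertion_cst[OF assms])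

section \<open>Partial derivatives\<close>

text \<open>This form of the derivative is free of truncated subtraction; additivity and commutation
  of derivatives follow by comparing coefficients.\<close>

lemma lookup_pdiff:
  "Poly_Mapping.lookup (pdiff i p) m =
     of_nat (Poly_Mapping.lookup m i + 1) * Poly_Mapping.lookup p (m + Poly_Mapping.single i 1)"
proof -
  let ?e = "Poly_Mapping.single i (1::nat)"
  \<comment> \<open>A monomial without the variable \<open>i\<close> may also truncate to
    \<open>m\<close>, but then its coefficient carries the factor 0.\<close>
  have *: "(of_nat (Poly_Mapping.lookup n i) * Poly_Mapping.lookup p n when n - ?e = m) =
      (if n = m + ?e then of_nat (Poly_Mapping.lookup m i + 1) * Poly_Mapping.lookup p n else 0)" for n
  proof (cases "Poly_Mapping.lookup n i = 0")
    case True
    then have "n \<noteq> m + ?e"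
      by (metis lookup_add lookup_single_eq add_is_0 zero_neq_one)
    then show ?thesis using True by (simp add: when_def)
  next
    case False
    then have "n - ?e + ?e = n"
      by (intro poly_mapping_eqI) (auto simp: lookup_add lookup_minus lookup_single when_def)
    moreover have "m + ?e - ?e = m"
      by simp
    ultimately have "n - ?e = m \<longleftrightarrow> n = m + ?e"
      by metis
    then show ?thesis
      by (auto simp: when_def lookup_add)
  qed
  show ?thesis
    unfolding pdiff_def lookup_sum lookup_single *
    by (auto simp: sum.delta in_keys_iff)
qed

lemma pdiff_add: "pdiff i (p + q) = pdiff i p + pdiff i q"
  by (rule poly_mapping_eqI) (simp add: lookup_pdiff lookup_add algebra_simps)

lemma pdiff_diff: "pdiff i (p - q) = pdiff i p - pdiff i q"
  by (rule poly_mapping_eqI) (simp add: lookup_pdiff lookup_minus algebra_simps)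

lemma pdiff_0 [simp]: "pdiff i 0 = 0"
  by (rule poly_mapping_eqI) (simp add: lookup_pdiff)

lemma pdiff_sum: "pdiff i (sum g A) = (\<Sum>x\<in>A. pdiff i (g x))"
  by (induction A rule: infinite_finite_induct) (auto simp: pdiff_add)

lemma pdiff_commute: "pdiff i (pdiff j p) = pdiff j (pdiff i p)"
  by (rule poly_mapping_eqI)
    (auto simp: lookup_pdiff lookup_add lookup_single when_def algebra_simps)

lemma pdiff_single:
  "pdiff i (Poly_Mapping.single m a) =
     Poly_Mapping.single (m - Poly_Mapping.single i 1) (of_nat (Poly_Mapping.lookup m i) * a)"
  by (auto simp: pdiff_def)

lemma pdiff_mult: "pdiff i (p * q) = pdiff i p * q + p * pdiff i (q :: 'v cpoly)"
proof (induction p rule: cpoly_single_induct)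
  case (3 m a)
  let ?e = "Poly_Mapping.single i (1::nat)"
  show ?case
  proof (induction q rule: cpoly_single_induct)
    case (3 n b)
    have eq: "m - ?e + n = m + n - ?e" if "Poly_Mapping.lookup m i \<noteq> 0" for m n :: "'v \<Rightarrow>\<^sub>0 nat"
      by (rule poly_mapping_eqI) (use that in \<open>auto simp: lookup_add lookup_minus lookup_single when_def\<close>)
    have 1: "Poly_Mapping.single (m - ?e + n) (of_nat (Poly_Mapping.lookup m i) * a * b) =
        Poly_Mapping.single (m + n - ?e) (of_nat (Poly_Mapping.lookup m i) * a * b)"
      by (cases "Poly_Mapping.lookup m i = 0") (auto simp: eq[simplified])
    have 2: "Poly_Mapping.single (m + (n - ?e)) (a * (of_nat (Poly_Mapping.lookup n i) * b)) =
        Poly_Mapping.single (m + n - ?e) (a * (of_nat (Poly_Mapping.lookup n i) * b))"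
      using eq[of n m, simplified] by (cases "Poly_Mapping.lookup n i = 0") (auto simp: add.commute)
    show ?case
      unfolding pdiff_single mult_single 1 2
      by (simp add: lookup_add algebra_simps flip: single_add)
  qed (simp_all add: pdiff_add algebra_simps)
qed (simp_all add: pdiff_add algebra_simps)

lemma pdiff_cst [simp]: "pdiff i (cst a) = 0"
  by (simp add: cst_def pdiff_single)

lemma pdiff_X: "pdiff i (X j) = (if i = j then 1 else 0)"
  by (auto simp: X_def pdiff_single lookup_single when_def single_one)

text \<open>The chain rule. Applied to \<open>f\<close> on the curve it makes the tangent vector
  orthogonal to the gradient.\<close>

lemma pderiv_insertion:
  "pderiv (insertion (\<lambda>c. [:c:]) u p) = (\<Sum>i\<in>UNIV. pderiv (u i) * insertion (\<lambda>c. [:c:]) u (pdiff i p))"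
proof (induction p rule: cpoly_induct)
  case (X j)
  have "(\<Sum>i\<in>UNIV. pderiv (u i) * insertion (\<lambda>c. [:c:]) u (pdiff i (X j))) =
      (\<Sum>i\<in>UNIV. if i = j then pderiv (u i) else 0)"
    by (rule sum.cong) (auto simp: pdiff_X insertion_simps[OF const_poly_hom])
  then show ?case
    by (simp add: insertion_X[OF const_poly_hom])
next
  case (mult p q)
  then show ?case
    by (simp add: insertion_simps[OF const_poly_hom] pdiff_mult pderiv_mult sum.distrib
        algebra_simps sum_distrib_left)
qed (simp_all add: insertion_simps[OF const_poly_hom] insertion_cst[OF const_poly_hom]
    pdiff_add pderiv_add sum.distrib algebra_simps pderiv_pCons)

text \<open>Taylor expansion to first order. The error is phrased as divisibility by
  \<open>y ^ 2\<close>; in the application \<open>y\<close> is the power of a local parameter that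
  measures the displacement from a node.\<close>

lemma insertion_taylor:
  assumes c: "comm_ring_hom c" and y: "\<And>i. y dvd b i"
  shows "y ^ 2 dvd insertion c (\<lambda>i. u i + b i) p - insertion c u p - (\<Sum>i\<in>UNIV. b i * insertion c u (pdiff i p))"
proof (induction p rule: cpoly_induct)
  case (cst a)
  then show ?case by (simp add: insertion_cst[OF c] insertion_simps[OF c])
next
  case (X j)
  have "(\<Sum>i\<in>UNIV. b i * insertion c u (pdiff i (X j))) = (\<Sum>i\<in>UNIV. if i = j then b i else 0)"
    by (rule sum.cong) (auto simp: pdiff_X insertion_simps[OF c])
  then show ?case
    by (simp add: insertion_X[OF c])
next
  case (add p q)
  from dvd_add[OF this] show ?case
    by (simp add: insertion_simps[OF c] pdiff_add sum.distrib algebra_simps)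
next
  case (mult p q)
  let ?P = "insertion c (\<lambda>i. u i + b i) p" and ?Q = "insertion c (\<lambda>i. u i + b i) q"
  let ?p = "insertion c u p" and ?q = "insertion c u q"
  let ?dp = "\<Sum>i\<in>UNIV. b i * insertion c u (pdiff i p)" and ?dq = "\<Sum>i\<in>UNIV. b i * insertion c u (pdiff i q)"
  have d: "(\<Sum>i\<in>UNIV. b i * insertion c u (pdiff i (p * q))) = ?dp * ?q + ?p * ?dq"
    by (simp add: insertion_simps[OF c] pdiff_mult sum.distrib algebra_simps sum_distrib_left)
  have "y dvd ?dp" "y dvd ?dq"
    by (auto intro!: dvd_sum dvd_mult2 y)
  then have "y ^ 2 dvd ?dp * ?dq"
    by (auto simp: power2_eq_square intro: mult_dvd_mono)
  \<comment> \<open>The error of a product combines the two errors, up to the product of the linear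
    terms, which is already divisible by \<open>y ^ 2\<close>.\<close>
  moreover have "?P * ?Q - ?p * ?q - (?dp * ?q + ?p * ?dq) =
      (?P - ?p - ?dp) * ?Q + (?p + ?dp) * (?Q - ?q - ?dq) + ?dp * ?dq"
    by (simp add: algebra_simps)
  ultimately show ?case
    unfolding d using mult by (simp add: insertion_simps[OF c] dvd_add)
qed

section \<open>Homogeneous polynomials\<close>

lemma mdeg_add: "mdeg (m + n) = mdeg m + mdeg n"
  by (simp add: mdeg_def lookup_add sum.distrib)

lemma mdeg_single [simp]: "mdeg (Poly_Mapping.single i n) = n"
  by (simp add: mdeg_def lookup_single when_def sum.delta)

lemma mdeg_0 [simp]: "mdeg 0 = 0"
  by (simp add: mdeg_def)

lemma homogeneous_iff: "homogeneous k p \<longleftrightarrow> (\<forall>m. Poly_Mapping.lookup p m \<noteq> 0 \<longrightarrow> mdeg m = k)"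
  by (auto simp: homogeneous_def in_keys_iff)

lemma homogeneous_0 [simp]: "homogeneous k 0"
  by (simp add: homogeneous_def)

lemma homogeneous_add: "homogeneous k p \<Longrightarrow> homogeneous k q \<Longrightarrow> homogeneous k (p + q)"
  by (auto simp: homogeneous_iff lookup_add) (metis add_0)

lemma homogeneous_diff: "homogeneous k p \<Longrightarrow> homogeneous k q \<Longrightarrow> homogeneous k (p - q)"
  by (auto simp: homogeneous_iff lookup_minus) (metis diff_zero)

lemma homogeneous_uminus: "homogeneous k p \<Longrightarrow> homogeneous k (- p)"
  by (auto simp: homogeneous_iff)

lemma homogeneous_mult: "homogeneous k p \<Longrightarrow> homogeneous l q \<Longrightarrow> homogeneous (k + l) (p * q)"
  using keys_mult[of p q] by (fastforce simp: homogeneous_def mdeg_add)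

lemma homogeneous_sum: "(\<And>x. x \<in> A \<Longrightarrow> homogeneous k (g x)) \<Longrightarrow> homogeneous k (sum g A)"
  by (induction A rule: infinite_finite_induct) (auto intro: homogeneous_add)

lemma homogeneous_cst [simp]: "homogeneous 0 (cst a)"
  by (simp add: homogeneous_def cst_def)

lemma homogeneous_X [simp]: "homogeneous 1 (X i)"
  by (simp add: homogeneous_def X_def)

lemma homogeneous_scale: "homogeneous k p \<Longrightarrow> homogeneous k (cst a * p)"
  using homogeneous_mult[OF homogeneous_cst] by fastforce

lemma homogeneous_X_mult: "homogeneous k p \<Longrightarrow> homogeneous (Suc k) (X i * p)"
  using homogeneous_mult[OF homogeneous_X] by fastforce

lemma homogeneous_power: "homogeneous k p \<Longrightarrow> homogeneous (k * n) (p ^ n)"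
proof (induction n)
  case 0
  then show ?case using homogeneous_cst[of 1] by simp
qed (auto simp: algebra_simps intro: homogeneous_mult)

lemma homogeneous_prod:
  "(\<And>x. x \<in> A \<Longrightarrow> homogeneous (e x) (g x)) \<Longrightarrow> homogeneous (\<Sum>x\<in>A. e x) (prod g A)"
  by (induction A rule: infinite_finite_induct)
    (use homogeneous_cst[of 1] in \<open>auto intro: homogeneous_mult\<close>)

lemma homogeneous_pdiff: "homogeneous k p \<Longrightarrow> homogeneous (k - 1) (pdiff i p)"
  by (force simp: homogeneous_iff lookup_pdiff mdeg_add)

lemma homogeneous_psubst:
  assumes "\<And>i. homogeneous m (v i)" "homogeneous k p"
  shows "homogeneous (m * k) (psubst v p)"
  unfolding psubst_def
proof (intro homogeneous_sum homogeneous_scale)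
  fix n assume "n \<in> Poly_Mapping.keys p"
  then have "(\<Sum>i\<in>UNIV. m * Poly_Mapping.lookup n i) = m * k"
    using assms(2) by (auto simp: homogeneous_def mdeg_def sum_distrib_left)
  then show "homogeneous (m * k) (\<Prod>i\<in>UNIV. v i ^ Poly_Mapping.lookup n i)"
    using homogeneous_prod[of UNIV "\<lambda>i. m * Poly_Mapping.lookup n i" "\<lambda>i. v i ^ Poly_Mapping.lookup n i"]
      homogeneous_power[OF assms(1)] by simp
qed

lemma degree_insertion_le:
  assumes "\<And>i. degree (u i) \<le> m" "homogeneous k p"
  shows "degree (insertion (\<lambda>c. [:c:]) u p) \<le> m * k"
  unfolding insertion_def
proof (intro degree_sum_le)
  fix n assume "n \<in> Poly_Mapping.keys p"
  then have k: "(\<Sum>i\<in>UNIV. m * Poly_Mapping.lookup n i) = m * k"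
    using assms(2) by (auto simp: homogeneous_def mdeg_def sum_distrib_left)
  have "degree (\<Prod>i\<in>UNIV. u i ^ Poly_Mapping.lookup n i) \<le> (\<Sum>i\<in>UNIV. degree (u i ^ Poly_Mapping.lookup n i))"
    using degree_prod_sum_le[of UNIV "\<lambda>i. u i ^ Poly_Mapping.lookup n i"] by (simp add: o_def)
  also have "\<dots> \<le> (\<Sum>i\<in>UNIV. m * Poly_Mapping.lookup n i)"
    by (intro sum_mono) (meson assms(1) degree_power_le le_trans mult_le_mono1)
  finally show "degree ([:Poly_Mapping.lookup p n:] * (\<Prod>i\<in>UNIV. u i ^ Poly_Mapping.lookup n i)) \<le> m * k"
    unfolding k by (simp add: order_trans[OF degree_smult_le])
qed simp

lemma insertion_scale:
  assumes "homogeneous k p"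
  shows "insertion c (\<lambda>i. g * v i) p = g ^ k * insertion c v p"
proof -
  have "(\<Prod>i\<in>UNIV. (g * v i) ^ Poly_Mapping.lookup m i) = g ^ k * (\<Prod>i\<in>UNIV. v i ^ Poly_Mapping.lookup m i)"
    if "m \<in> Poly_Mapping.keys p" for m
    using assms that
    by (auto simp: homogeneous_def mdeg_def power_mult_distrib prod.distrib simp flip: power_sum)
  then show ?thesis
    unfolding insertion_def by (simp add: sum_distrib_left mult_ac)
qed

lemma euler:
  assumes "homogeneous k p"
  shows "(\<Sum>i\<in>UNIV. X i * pdiff i p) = of_nat k * p"
proof -
  have *: "X i * Poly_Mapping.single (m - Poly_Mapping.single i 1) (of_nat (Poly_Mapping.lookup m i) * a) =
      Poly_Mapping.single m (of_nat (Poly_Mapping.lookup m i) * a :: complex)" for i :: 'a and m a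
  proof (cases "Poly_Mapping.lookup m i = 0")
    case False
    then have "Poly_Mapping.single i 1 + (m - Poly_Mapping.single i 1) = m"
      by (intro poly_mapping_eqI) (auto simp: lookup_add lookup_minus lookup_single when_def)
    then show ?thesis
      by (simp add: X_def mult_single)
  qed simp
  have "(\<Sum>i\<in>UNIV. X i * pdiff i p) =
      (\<Sum>i\<in>UNIV. \<Sum>m\<in>Poly_Mapping.keys p. Poly_Mapping.single m (of_nat (Poly_Mapping.lookup m i) * Poly_Mapping.lookup p m))"
    by (simp add: pdiff_def sum_distrib_left * del: One_nat_def)
  also have "\<dots> = (\<Sum>m\<in>Poly_Mapping.keys p. \<Sum>i\<in>UNIV. Poly_Mapping.single m (of_nat (Poly_Mapping.lookup m i) * Poly_Mapping.lookup p m))"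
    by (rule sum.swap)
  also have "\<dots> = (\<Sum>m\<in>Poly_Mapping.keys p. cst (of_nat k) * Poly_Mapping.single m (Poly_Mapping.lookup p m))"
  proof (rule sum.cong)
    fix m assume "m \<in> Poly_Mapping.keys p"
    then have "mdeg m = k" using assms by (simp add: homogeneous_def)
    moreover have "(\<Sum>i\<in>A. Poly_Mapping.single m (of_nat (Poly_Mapping.lookup m i) * Poly_Mapping.lookup p m)) =
      Poly_Mapping.single m (of_nat (\<Sum>i\<in>A. Poly_Mapping.lookup m i) * Poly_Mapping.lookup p m)" for A
      by (induction A rule: infinite_finite_induct) (auto simp: single_add algebra_simps)
    ultimately show "(\<Sum>i\<in>UNIV. Poly_Mapping.single m (of_nat (Poly_Mapping.lookup m i) * Poly_Mapping.lookup p m)) =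
        cst (of_nat k) * Poly_Mapping.single m (Poly_Mapping.lookup p m)"
      by (simp add: cst_def mult_single mdeg_def del: of_nat_sum single_of_nat)
  qed simp
  also have "\<dots> = of_nat k * p"
    by (subst (3) cpoly_eq_sum_single) (simp add: sum_distrib_left cst_of_nat)
  finally show ?thesis .
qed

lemma lookup_hcomp: "Poly_Mapping.lookup (hcomp k p) m = (if mdeg m = k then Poly_Mapping.lookup p m else 0)"
proof -
  have "finite {m \<in> Poly_Mapping.keys p. mdeg m = k}"
    by simp
  then show ?thesis
    unfolding hcomp_def lookup_sum lookup_single
    by (auto simp: when_def sum.delta in_keys_iff)
qed

lemma homogeneous_hcomp [simp]: "homogeneous k (hcomp k p)"
  by (auto simp: homogeneous_iff lookup_hcomp split: if_splits)

lemma hcomp_add: "hcomp k (p + q) = hcomp k p + hcomp k q"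
  by (rule poly_mapping_eqI) (simp add: lookup_hcomp lookup_add)

lemma hcomp_0 [simp]: "hcomp k 0 = 0"
  by (rule poly_mapping_eqI) (simp add: lookup_hcomp)

lemma hcomp_sum: "hcomp k (sum g A) = (\<Sum>x\<in>A. hcomp k (g x))"
  by (induction A rule: infinite_finite_induct) (auto simp: hcomp_add)

lemma hcomp_homogeneous: "homogeneous k p \<Longrightarrow> hcomp l p = (if l = k then p else 0)"
  by (rule poly_mapping_eqI) (auto simp: lookup_hcomp homogeneous_iff)

lemma hcomp_mult_left:
  assumes "homogeneous d p"
  shows "hcomp k (p * q) = (if d \<le> k then p * hcomp (k - d) q else 0)"
proof (induction q rule: cpoly_single_induct)
  case (3 n b)
  have "homogeneous (mdeg n) (Poly_Mapping.single n b)"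
    by (simp add: homogeneous_def)
  moreover from this have "homogeneous (d + mdeg n) (p * Poly_Mapping.single n b)"
    using assms homogeneous_mult by blast
  ultimately show ?case
    by (auto simp: hcomp_homogeneous)
qed (auto simp: hcomp_add algebra_simps)

text \<open>An arbitrary cofactor can be replaced by its component of degree \<open>k - d\<close>,
  because \<open>p\<close> shifts degrees by exactly \<open>d\<close>.\<close>

lemma homogeneous_dvdE:
  assumes "homogeneous d p" "homogeneous k q" "p dvd q" "q \<noteq> 0"
  obtains r where "d \<le> k" "homogeneous (k - d) r" "q = p * r"
proof -
  from assms(3) obtain r where r: "q = p * r" ..
  have "hcomp k q = q" by (simp add: hcomp_homogeneous[OF assms(2)])
  then have "d \<le> k" "q = p * hcomp (k - d) r"
    using assms(4) unfolding r by (auto simp: hcomp_mult_left[OF assms(1)] split: if_splits)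
  then show ?thesis using that homogeneous_hcomp by blast
qed

section \<open>Index types with two and three elements, binary forms, number of monomials\<close>

lemma UNIV_3: "(UNIV :: 3 set) = {0, 1, 2}"
proof -
  have "card {0, 1, 2 :: 3} = CARD(3)" by simp
  then show ?thesis by (metis card_subset_eq finite subset_UNIV)
qed

lemma UNIV_2: "(UNIV :: 2 set) = {0, 1}"
proof -
  have "card {0, 1 :: 2} = CARD(2)" by simp
  then show ?thesis by (metis card_subset_eq finite subset_UNIV)
qed

lemma sum_3: "(\<Sum>i\<in>UNIV. g i) = g 0 + g 1 + g (2 :: 3)"
proof -
  have "sum g {0, 1, 2 :: 3} = g 0 + (g 1 + g 2)"
    by (subst sum.insert; simp)+
  then show ?thesis
    by (simp only: UNIV_3 add.assoc)
qed

lemma forall_3: "(\<forall>i :: 3. P i) \<longleftrightarrow> P 0 \<and> P 1 \<and> P 2"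
proof -
  have "(\<forall>i :: 3. P i) \<longleftrightarrow> (\<forall>i\<in>UNIV. P i)" by simp
  then show ?thesis unfolding UNIV_3 by simp
qed

lemma exists_3: "(\<exists>i :: 3. P i) \<longleftrightarrow> P 0 \<or> P 1 \<or> P 2"
  using forall_3[of "\<lambda>i. \<not> P i"] by blast

lemma forall_2: "(\<forall>i :: 2. P i) \<longleftrightarrow> P 0 \<and> P 1"
proof -
  have "(\<forall>i :: 2. P i) \<longleftrightarrow> (\<forall>i\<in>UNIV. P i)" by simp
  then show ?thesis unfolding UNIV_2 by simp
qed

lemma insertion_binary_form:
  assumes "homogeneous M (h :: 2 cpoly)" "comm_ring_hom c"
  shows "insertion c v h = (\<Sum>i\<le>M. c (Poly_Mapping.lookup h
     (Poly_Mapping.single 0 i + Poly_Mapping.single 1 (M - i))) * (v 0 ^ i * v 1 ^ (M - i)))"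
proof -
  let ?g = "\<lambda>i. Poly_Mapping.single (0 :: 2) i + Poly_Mapping.single 1 (M - i)"
  interpret c: comm_ring_hom c by fact
  have inj: "inj_on ?g {..M}"
    by (rule inj_onI, drule arg_cong[of _ _ "\<lambda>m. Poly_Mapping.lookup m 0"])
      (simp add: lookup_add lookup_single)
  have "m \<in> ?g ` {..M}" if "m \<in> Poly_Mapping.keys h" for m
  proof
    have "Poly_Mapping.lookup m 0 + Poly_Mapping.lookup m 1 = M"
      using assms(1) that by (auto simp: homogeneous_def mdeg_def UNIV_2)
    then show "Poly_Mapping.lookup m 0 \<in> {..M}" "m = ?g (Poly_Mapping.lookup m 0)"
      by (auto intro!: poly_mapping_eqI simp: lookup_add lookup_single when_def)
        (metis UNIV_2 UNIV_I empty_iff insert_iff)+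
  qed
  then have "insertion c v h = (\<Sum>m\<in>?g ` {..M}. c (Poly_Mapping.lookup h m) * (\<Prod>i\<in>UNIV. v i ^ Poly_Mapping.lookup m i))"
    by (intro insertion_superset) auto
  then show ?thesis
    by (simp add: sum.reindex[OF inj] UNIV_2 lookup_add lookup_single)
qed

lemma homogeneous_binary_eq_0:
  assumes "homogeneous M (h :: 2 cpoly)"
    "\<And>i. i \<le> M \<Longrightarrow> Poly_Mapping.lookup h (Poly_Mapping.single 0 i + Poly_Mapping.single 1 (M - i)) = 0"
  shows "h = 0"
proof (rule poly_mapping_eqI)
  fix m
  show "Poly_Mapping.lookup h m = Poly_Mapping.lookup 0 m"
  proof (cases "mdeg m = M")
    case True
    then have "Poly_Mapping.lookup m 0 + Poly_Mapping.lookup m 1 = M"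
      by (auto simp: mdeg_def UNIV_2)
    then have "m = Poly_Mapping.single 0 (Poly_Mapping.lookup m 0) + Poly_Mapping.single 1 (M - Poly_Mapping.lookup m 0)"
      "Poly_Mapping.lookup m 0 \<le> M"
      by (auto intro!: poly_mapping_eqI simp: lookup_add lookup_single when_def)
        (metis UNIV_2 UNIV_I empty_iff insert_iff)+
    then show ?thesis using assms(2) by (metis lookup_zero)
  qed (use assms(1) in \<open>auto simp: homogeneous_iff\<close>)
qed

lemma card_mdeg:
  shows "finite {m :: 3 \<Rightarrow>\<^sub>0 nat. mdeg m = k}"
    and "card {m :: 3 \<Rightarrow>\<^sub>0 nat. mdeg m = k} = (k + 2) choose 2"
proof -
  let ?S = "SIGMA a:{..k}. {..k - a}"
  let ?g = "\<lambda>(a, b). Poly_Mapping.single (0::3) a + Poly_Mapping.single 1 b + Poly_Mapping.single 2 (k - a - b)"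
  have inj: "inj_on ?g ?S"
  proof (rule inj_onI)
    fix x y
    assume "?g x = ?g y"
    then have "Poly_Mapping.lookup (?g x) 0 = Poly_Mapping.lookup (?g y) 0"
      "Poly_Mapping.lookup (?g x) 1 = Poly_Mapping.lookup (?g y) 1"
      by auto
    then show "x = y"
      by (cases x; cases y) (simp add: lookup_add lookup_single)
  qed
  have img: "?g ` ?S = {m. mdeg m = k}"
  proof (intro equalityI subsetI)
    fix m :: "3 \<Rightarrow>\<^sub>0 nat" assume "m \<in> {m. mdeg m = k}"
    then have *: "Poly_Mapping.lookup m 0 + Poly_Mapping.lookup m 1 + Poly_Mapping.lookup m 2 = k"
      by (simp add: mdeg_def sum_3)
    have "Poly_Mapping.lookup m i = Poly_Mapping.lookup (?g (Poly_Mapping.lookup m 0, Poly_Mapping.lookup m 1)) i" for i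
    proof -
      have "\<forall>i. Poly_Mapping.lookup m i = Poly_Mapping.lookup (?g (Poly_Mapping.lookup m 0, Poly_Mapping.lookup m 1)) i"
        unfolding forall_3 using * by (simp add: lookup_add lookup_single)
      then show ?thesis by blast
    qed
    then have "m = ?g (Poly_Mapping.lookup m 0, Poly_Mapping.lookup m 1)"
      by (rule poly_mapping_eqI)
    moreover have "(Poly_Mapping.lookup m 0, Poly_Mapping.lookup m 1) \<in> ?S"
      using * by auto
    ultimately show "m \<in> ?g ` ?S" by blast
  qed (auto simp: mdeg_add)
  show "finite {m :: 3 \<Rightarrow>\<^sub>0 nat. mdeg m = k}"
    unfolding img[symmetric] by auto
  have "card {m :: 3 \<Rightarrow>\<^sub>0 nat. mdeg m = k} = card ?S"
    unfolding img[symmetric] by (rule card_image[OF inj])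
  also have "\<dots> = (\<Sum>a\<le>k. Suc (k - a))"
    by simp
  also have "\<dots> = (\<Sum>a\<le>k. Suc a)"
    by (rule sum.reindex_bij_witness[of _ "\<lambda>a. k - a" "\<lambda>a. k - a"]) auto
  also have "\<dots> = (k + 2) choose 2"
    by (induction k) (auto simp: choose_two numeral_2_eq_2)
  finally show "card {m :: 3 \<Rightarrow>\<^sub>0 nat. mdeg m = k} = (k + 2) choose 2" .
qed

section \<open>Dimensions\<close>

context vector_space
begin

text \<open>\<open>dim\<close> is the cardinality of a basis as a natural number, hence 0 when every
  basis is infinite. Monotonicity and rank-nullity therefore carry this hypothesis along.\<close>

definition fin_dim :: "'b set \<Rightarrow> bool" where
  "fin_dim V \<longleftrightarrow> (\<exists>T. finite T \<and> V \<subseteq> span T)"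

end

(* Reopened because within the context of its definition fin_dim would denote real_vector.fin_dim. *)
context vector_space
begin

lemma fin_dim_subset: "V \<subseteq> W \<Longrightarrow> fin_dim W \<Longrightarrow> fin_dim V"
  unfolding fin_dim_def by blast

lemma fin_dim_independent_finite: "fin_dim V \<Longrightarrow> B \<subseteq> V \<Longrightarrow> independent B \<Longrightarrow> finite B"
  unfolding fin_dim_def using independent_span_bound by blast

lemma dim_mono:
  assumes "V \<subseteq> W" "fin_dim W"
  shows "dim V \<le> dim W"
proof -
  obtain B where "B \<subseteq> W" "independent B" "W \<subseteq> span B" "card B = dim W"
    using basis_exists by blast
  moreover from this have "finite B"
    using assms(2) fin_dim_independent_finite by blast
  ultimately show ?thesis
    using assms(1) dim_le_card[of V B] by simp
qed

lemma dim_eq_card_coordinates: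
  assumes I: "finite I" and e: "\<And>i. i \<in> I \<Longrightarrow> e i \<in> V"
    and L: "\<And>v. v \<in> V \<Longrightarrow> v = (\<Sum>i\<in>I. L i v *s e i)"
    and indep: "\<And>u i. (\<Sum>i\<in>I. u i *s e i) = 0 \<Longrightarrow> i \<in> I \<Longrightarrow> u i = 0"
  shows "dim V = card I" "fin_dim V"
proof -
  have inj: "inj_on e I"
  proof (rule inj_onI, rule ccontr)
    fix i j assume ij: "i \<in> I" "j \<in> I" "e i = e j" "i \<noteq> j"
    \<comment> \<open>Two equal generators would give a relation with coefficients 1 and -1.\<close>
    let ?u = "\<lambda>k. if k = i then 1 else if k = j then - 1 else 0"
    have "(\<Sum>k\<in>I. ?u k *s e k) = (\<Sum>k\<in>I. (if k = i then e i else 0) - (if k = j then e j else 0))"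
      by (rule sum.cong) (use ij in auto)
    also have "\<dots> = 0"
      using ij I by (simp add: sum_subtractf sum.delta)
    finally show False
      using indep[of ?u i] ij by simp
  qed
  have span: "V \<subseteq> span (e ` I)"
  proof
    fix v assume "v \<in> V"
    have "(\<Sum>i\<in>I. L i v *s e i) \<in> span (e ` I)"
      by (intro span_sum span_scale span_base imageI)
    with L[OF \<open>v \<in> V\<close>] show "v \<in> span (e ` I)"
      by simp
  qed
  have "independent (e ` I)"
  proof (rule independent_if_scalars_zero)
    fix g x assume *: "(\<Sum>x\<in>e ` I. g x *s x) = 0" "x \<in> e ` I"
    then have "(\<Sum>i\<in>I. g (e i) *s e i) = 0"
      by (simp add: sum.reindex[OF inj])
    then show "g x = 0" using indep[of "\<lambda>i. g (e i)"] * by auto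
  qed (use I in simp)
  then have "dim V = card (e ` I)"
    using span e by (intro dim_unique) auto
  then show "dim V = card I"
    by (simp add: card_image inj)
  show "fin_dim V"
    unfolding fin_dim_def using span I by blast
qed

end

context Vector_Spaces.linear
begin

lemma fin_dim_image: "vs1.fin_dim V \<Longrightarrow> vs2.fin_dim (f ` V)"
  unfolding vs1.fin_dim_def vs2.fin_dim_def
proof (elim exE conjE)
  fix T assume "finite T" "V \<subseteq> vs1.span T"
  then have "finite (f ` T) \<and> f ` V \<subseteq> vs2.span (f ` T)"
    by (auto simp: span_image)
  then show "\<exists>T. finite T \<and> f ` V \<subseteq> vs2.span T" ..
qed

text \<open>Rank-nullity on a subspace: a basis of the kernel is extended to a basis of
  \<open>V\<close>, and the map is injective on the span of the added vectors
  \<open>C\<close>.\<close>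

theorem dim_kernel_image:
  assumes V: "vs1.subspace V" and fin: "vs1.fin_dim V"
  shows "vs1.dim V = vs1.dim {x \<in> V. f x = 0} + vs2.dim (f ` V)"
proof -
  let ?K = "{x \<in> V. f x = 0}"
  obtain B0 where B0: "B0 \<subseteq> ?K" "vs1.independent B0" "?K \<subseteq> vs1.span B0" "card B0 = vs1.dim ?K"
    using vs1.basis_exists by blast
  have "B0 \<subseteq> V"
    using B0(1) by blast
  obtain B where B: "B0 \<subseteq> B" "B \<subseteq> V" "vs1.independent B" "V \<subseteq> vs1.span B"
    by (rule vs1.maximal_independent_subset_extend[OF \<open>B0 \<subseteq> V\<close> B0(2)])
  define C where "C = B - B0"
  have finB: "finite B"
    using B fin vs1.fin_dim_independent_finite by blast
  then have finC: "finite C" and finB0: "finite B0" and disj: "C \<inter> B0 = {}" "C \<union> B0 = B"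
    using B(1) by (auto simp: C_def finite_subset)
  have indC: "vs1.independent C"
    using B(3) vs1.independent_mono C_def by blast
  have "x = 0" if x: "x \<in> vs1.span C" "f x = 0" for x
  proof -
    have "x \<in> V"
      using x(1) V B(2) C_def vs1.span_minimal[of C V] by auto
    then have "x \<in> vs1.span B0"
      using x B0(3) by blast
    then obtain w where w: "x = (\<Sum>b\<in>B0. w b *a b)"
      using vs1.span_finite[OF finB0] by auto
    obtain u where u: "x = (\<Sum>b\<in>C. u b *a b)"
      using x(1) vs1.span_finite[OF finC] by auto
    \<comment> \<open>The difference of the two expansions of \<open>x\<close>, over
      \<open>C\<close> and over \<open>B0\<close>, is a relation in the basis
      \<open>B\<close>.\<close>
    let ?g = "\<lambda>b. if b \<in> C then u b else - w b"
    have "(\<Sum>b\<in>B. ?g b *a b) = (\<Sum>b\<in>C. ?g b *a b) + (\<Sum>b\<in>B0. ?g b *a b)"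
      unfolding disj(2)[symmetric] by (rule sum.union_disjoint[OF finC finB0 disj(1)])
    also have "(\<Sum>b\<in>C. ?g b *a b) = x"
      unfolding u by (rule sum.cong) auto
    also have "(\<Sum>b\<in>B0. ?g b *a b) = - x"
      unfolding w sum_negf[symmetric] by (rule sum.cong) (use disj in auto)
    finally have "(\<Sum>b\<in>B. ?g b *a b) = 0"
      by simp
    then have "\<not> (\<exists>b\<in>B. ?g b \<noteq> 0)"
      using B(3) vs1.dependent_finite[OF finB, THEN iffD2, OF exI, OF conjI, of ?g] by argo
    then have "\<forall>b\<in>C. u b = 0"
      unfolding C_def by auto
    then show "x = 0" unfolding u by simp
  qed
  then have inj: "inj_on f (vs1.span C)"
    by (subst inj_on_iff_eq_0) auto
  then have "vs2.independent (f ` C)"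
    using indC by (rule independent_injective_image[rotated])
  moreover have "f ` V \<subseteq> vs2.span (f ` C)"
  proof
    fix y assume "y \<in> f ` V"
    then obtain v where v: "v \<in> V" "y = f v" by blast
    then have "v \<in> vs1.span (C \<union> B0)"
      using B(4) disj by auto
    then obtain a b where ab: "v = a + b" "a \<in> vs1.span C" "b \<in> vs1.span B0"
      unfolding vs1.span_Un by blast
    have "vs1.span B0 \<subseteq> {x. f x = 0}"
      using B0(1) by (intro vs1.span_minimal subspace_kernel) auto
    then show "y \<in> vs2.span (f ` C)"
      using ab v by (auto simp: add span_image)
  qed
  moreover have "f ` C \<subseteq> f ` V"
    using B(2) C_def by blast
  ultimately have "vs2.dim (f ` V) = card (f ` C)"
    by (intro vs2.dim_unique) auto
  also have "\<dots> = card C"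
    using inj by (intro card_image) (meson inj_on_subset vs1.span_superset)
  finally have "vs2.dim (f ` V) = card C" .
  moreover have "vs1.dim V = card B"
    using B by (intro vs1.dim_unique) auto
  moreover have "card B = card C + card B0"
    unfolding disj(2)[symmetric] by (rule card_Un_disjoint[OF finC finB0 disj(1)])
  ultimately show ?thesis using B0(4) by simp
qed

text \<open>The dimension counts know only supersets of the kernel and of the image, so they use
  rank-nullity in this form.\<close>

corollary dim_le_kernel_image:
  assumes "vs1.subspace V" "vs1.fin_dim V"
    "\<And>x. x \<in> V \<Longrightarrow> f x = 0 \<Longrightarrow> x \<in> K" "vs1.fin_dim K" "f ` V \<subseteq> W" "vs2.fin_dim W"
  shows "vs1.dim V \<le> vs1.dim K + vs2.dim W"
proof -
  have "vs1.dim {x \<in> V. f x = 0} \<le> vs1.dim K"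
    using assms by (intro vs1.dim_mono) auto
  moreover have "vs2.dim (f ` V) \<le> vs2.dim W"
    using assms by (intro vs2.dim_mono) auto
  ultimately show ?thesis
    using dim_kernel_image[OF assms(1,2)] by linarith
qed

corollary dim_le_of_inj:
  assumes "vs1.subspace V" "vs1.fin_dim V" "\<And>x. x \<in> V \<Longrightarrow> f x = 0 \<Longrightarrow> x = 0"
    "f ` V \<subseteq> W" "vs2.fin_dim W"
  shows "vs1.dim V \<le> vs2.dim W"
proof -
  have "vs1.fin_dim {0}" unfolding vs1.fin_dim_def using vs1.span_superset by blast
  then have "vs1.dim V \<le> vs1.dim {0} + vs2.dim W"
    using assms by (intro dim_le_kernel_image) auto
  moreover have "vs1.dim {0} = 0"
    using vs1.dim_le_card[of "{0}" "{}"] by simp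
  ultimately show ?thesis by simp
qed

corollary dim_image_le:
  assumes "vs1.subspace V" "vs1.fin_dim V"
  shows "vs2.dim (f ` V) \<le> vs1.dim V"
  using dim_kernel_image[OF assms] by simp

end

section \<open>Prime elements\<close>

text \<open>Iterated polynomials in one variable form a factorial ring, and primality of irreducible
  elements is transferred from there. Variable 0 is the outermost one.\<close>

definition cpoly_to_poly :: "3 cpoly \<Rightarrow> complex poly poly poly" where
  "cpoly_to_poly = insertion (\<lambda>c. [:[:[:c:]:]:])
     (\<lambda>i. if i = 0 then [:0, 1:] else if i = 1 then [:[:0, 1:]:] else [:[:[:0, 1:]:]:])"

lemma const_poly3_hom: "comm_ring_hom (\<lambda>c :: complex. [:[:[:c:]:]:])"
  by unfold_locales (simp_all add: one_pCons)

lemma const_poly_power: "[:a :: 'a::comm_semiring_1:] ^ n = [:a ^ n:]"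
  by (induction n) (simp_all add: one_pCons mult.commute)

lemma X_poly_power: "[:0, 1 :: 'a::comm_semiring_1:] ^ n = monom 1 n"
  by (simp add: monom_altdef)

lemma prod_3: "(\<Prod>i\<in>UNIV. g i) = g 0 * g 1 * g (2 :: 3)"
proof -
  have "prod g {0, 1, 2 :: 3} = g 0 * (g 1 * g 2)"
    by (subst prod.insert; simp)+
  then show ?thesis
    by (simp only: UNIV_3 mult.assoc)
qed

lemma cpoly_to_poly_single:
  "cpoly_to_poly (Poly_Mapping.single m a) = monom (monom (monom a (Poly_Mapping.lookup m 2))
     (Poly_Mapping.lookup m 1)) (Poly_Mapping.lookup m 0)"
  unfolding cpoly_to_poly_def insertion_single[OF const_poly3_hom]
  by (simp add: prod_3 const_poly_power X_poly_power smult_monom)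

lemma cpoly_to_poly_hom: "comm_ring_hom cpoly_to_poly"
  unfolding cpoly_to_poly_def by (rule insertion_hom[OF const_poly3_hom])

lemma coeff_cpoly_to_poly:
  "coeff (coeff (coeff (cpoly_to_poly p) a) b) c = Poly_Mapping.lookup p
     (Poly_Mapping.single 0 a + Poly_Mapping.single 1 b + Poly_Mapping.single 2 c)" (is "_ = Poly_Mapping.lookup p ?m")
proof (induction p rule: cpoly_single_induct)
  case (3 m k)
  have "m = ?m \<longleftrightarrow> (\<forall>i. Poly_Mapping.lookup m i = Poly_Mapping.lookup ?m i)"
    by (metis poly_mapping_eqI)
  also have "\<dots> \<longleftrightarrow> Poly_Mapping.lookup m 0 = a \<and> Poly_Mapping.lookup m 1 = b \<and> Poly_Mapping.lookup m 2 = c"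
    by (simp add: forall_3 lookup_add lookup_single)
  finally show ?case
    by (auto simp: cpoly_to_poly_single lookup_single when_def)
qed (simp_all add: comm_ring_hom.hom_zero[OF cpoly_to_poly_hom]
    comm_ring_hom.hom_add[OF cpoly_to_poly_hom] lookup_add)

lemma poly_monom_induct:
  assumes "P 0" "\<And>p q. P p \<Longrightarrow> P q \<Longrightarrow> P (p + q)" "\<And>a n. P (monom a n)"
  shows "P (p :: 'a::comm_monoid_add poly)"
proof -
  have "P (\<Sum>i\<le>n. monom (coeff p i) i)" for n
    by (induction n) (auto intro: assms)
  from this[of "degree p"] show ?thesis
    by (simp add: poly_as_sum_of_monoms)
qed

text \<open>Injective because the nested coefficients recover all coefficients; surjective because
  the range is closed under sums and, layer by layer, contains all nested monomials.\<close>

lemma bij_cpoly_to_poly: "bij cpoly_to_poly"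
proof (rule bijI)
  interpret comm_ring_hom cpoly_to_poly by (rule cpoly_to_poly_hom)
  show "inj cpoly_to_poly"
  proof (rule injI)
    fix p q assume eq: "cpoly_to_poly p = cpoly_to_poly q"
    show "p = q"
    proof (rule poly_mapping_eqI)
      fix m :: "3 \<Rightarrow>\<^sub>0 nat"
      let ?m = "Poly_Mapping.single 0 (Poly_Mapping.lookup m 0) + Poly_Mapping.single 1 (Poly_Mapping.lookup m 1) +
        Poly_Mapping.single 2 (Poly_Mapping.lookup m 2)"
      have "\<forall>i. Poly_Mapping.lookup m i = Poly_Mapping.lookup ?m i"
        by (simp add: forall_3 lookup_add lookup_single)
      then have "m = ?m"
        by (intro poly_mapping_eqI) blast
      then obtain a b c where "m = Poly_Mapping.single 0 a + Poly_Mapping.single 1 b + Poly_Mapping.single 2 c"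
        by blast
      then show "Poly_Mapping.lookup p m = Poly_Mapping.lookup q m"
        by (simp add: eq flip: coeff_cpoly_to_poly)
    qed
  qed
  have add: "p + q \<in> range cpoly_to_poly" if "p \<in> range cpoly_to_poly" "q \<in> range cpoly_to_poly" for p q
    using that by (auto simp flip: hom_add)
  have zero: "0 \<in> range cpoly_to_poly"
    by (rule range_eqI[of _ _ 0]) simp
  have 1: "monom (monom (monom k c) b) a \<in> range cpoly_to_poly" for a b c k
  proof
    show "monom (monom (monom k c) b) a = cpoly_to_poly
        (Poly_Mapping.single (Poly_Mapping.single 0 a + Poly_Mapping.single 1 b + Poly_Mapping.single 2 c) k)"
      by (simp add: cpoly_to_poly_single lookup_add lookup_single)
  qed simp
  have 2: "monom (monom q b) a \<in> range cpoly_to_poly" for a b q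
    by (induction q rule: poly_monom_induct) (use zero 1 add in \<open>auto simp flip: add_monom\<close>)
  have 3: "monom q a \<in> range cpoly_to_poly" for a q
    by (induction q rule: poly_monom_induct) (use zero 2 add in \<open>auto simp flip: add_monom\<close>)
  have "q \<in> range cpoly_to_poly" for q
    by (induction q rule: poly_monom_induct) (use zero 3 add in auto)
  then show "surj cpoly_to_poly" by blast
qed

text \<open>Primality is what allows a factor that does not vanish on the curve to be cancelled
  modulo \<open>f\<close>.\<close>

lemma irreducible_imp_prime_elem_cpoly:
  assumes "irreducible (f :: 3 cpoly)"
  shows "prime_elem f"
proof -
  let ?h = "cpoly_to_poly"
  interpret comm_ring_hom ?h by (rule cpoly_to_poly_hom)
  have inj: "?h a = ?h b \<longleftrightarrow> a = b" for a b
    using bij_cpoly_to_poly by (auto simp: bij_def inj_eq)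
  have surj: "\<exists>a. ?h a = b" for b
    using bij_cpoly_to_poly by (metis bij_pointE)
  have dvd: "?h a dvd ?h b \<longleftrightarrow> a dvd b" for a b
  proof
    assume "?h a dvd ?h b"
    then obtain c where "?h b = ?h a * ?h c" using surj by (metis dvdE)
    then show "a dvd b" by (metis hom_mult inj dvd_triv_left)
  qed (metis dvd_def hom_mult)
  have "irreducible (?h f)"
  proof (rule irreducibleI)
    show "?h f \<noteq> 0"
      using assms inj hom_zero by (metis irreducible_def)
    show "\<not> ?h f dvd 1"
      using assms dvd hom_one by (metis irreducible_def)
    fix a b assume "?h f = a * b"
    moreover obtain a' b' where "a = ?h a'" "b = ?h b'" using surj by metis
    ultimately have "f = a' * b'" by (metis hom_mult inj)
    then have "a' dvd 1 \<or> b' dvd 1" using assms irreducibleD by blast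
    then show "a dvd 1 \<or> b dvd 1" using dvd hom_one \<open>a = _\<close> \<open>b = _\<close> by metis
  qed
  then have pr: "prime_elem (?h f)"
    by (rule irreducible_imp_prime_elem)
  show ?thesis
  proof (rule prime_elemI)
    show "f \<noteq> 0" "\<not> f dvd 1" using assms by (auto simp: irreducible_def)
    fix a b assume "f dvd a * b"
    then have "?h f dvd ?h a * ?h b" using dvd hom_mult by metis
    then show "f dvd a \<or> f dvd b" using pr dvd prime_elem_dvd_multD by blast
  qed
qed

lemma irreducible_imp_squarefree:
  assumes "irreducible (f :: 3 cpoly)"
  shows "squarefree f"
proof (rule squarefreeI)
  fix y assume "y\<^sup>2 dvd f"
  then obtain r where r: "f = y * (y * r)"
    by (metis dvdE mult.assoc power2_eq_square)
  then have "y dvd 1 \<or> y * r dvd 1" using assms irreducibleD by blast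
  then show "y dvd 1" by (meson dvd_mult_left)
qed

lemma insertion_dvd_diff:
  assumes "comm_ring_hom c" "\<And>i. f dvd u i - v i"
  shows "f dvd insertion c u p - insertion c v p"
proof (induction p rule: cpoly_induct)
  case (add p q)
  have "insertion c u (p + q) - insertion c v (p + q) =
      (insertion c u p - insertion c v p) + (insertion c u q - insertion c v q)"
    by (simp add: insertion_simps[OF assms(1)])
  then show ?case using add by (metis dvd_add)
next
  case (mult p q)
  have "insertion c u (p * q) - insertion c v (p * q) =
      (insertion c u p - insertion c v p) * insertion c u q + insertion c v p * (insertion c u q - insertion c v q)"
    by (simp add: insertion_simps[OF assms(1)] algebra_simps)
  then show ?case using mult by (metis dvd_add dvd_mult dvd_mult2)
qed (use assms in \<open>auto simp: insertion_cst insertion_X\<close>)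

lemma insertion_id: "insertion cst X p = p"
  by (induction p rule: cpoly_induct)
    (simp_all add: insertion_cst[OF cst_hom] insertion_X[OF cst_hom] insertion_simps[OF cst_hom])

text \<open>Modulo \<open>f\<close>, the vector \<open>\<phi> \<circ> \<psi>\<close> is proportional to the vector of the variables.\<close>

lemma dvd_of_psubst_eq_0:
  fixes \<phi> :: "'v::finite \<Rightarrow> 'w::finite cpoly"
  assumes f: "prime_elem f" and P: "homogeneous k P" "psubst \<phi> P = 0"
    and par: "\<And>i k. f dvd X i * psubst \<psi> (\<phi> k) - X k * psubst \<psi> (\<phi> i)"
    and k0: "\<not> f dvd psubst \<psi> (\<phi> k0)"
  shows "f dvd P"
proof -
  let ?w = "\<lambda>i. psubst \<psi> (\<phi> i)"
  \<comment> \<open>The two argument vectors agree modulo \<open>f\<close>. Homogeneity pulls the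
    powers of \<open>?w k0\<close> and \<open>X k0\<close> out of the two values, and the second
    value is 0 because \<phi> annihilates \<open>P\<close>.\<close>
  have "f dvd insertion cst (\<lambda>i. ?w k0 * X i) P - insertion cst (\<lambda>i. X k0 * ?w i) P"
    by (rule insertion_dvd_diff[OF cst_hom]) (use par in \<open>simp add: mult.commute\<close>)
  moreover have "insertion cst (\<lambda>i. X k0 * ?w i) P = X k0 ^ k * psubst \<psi> (psubst \<phi> P)"
    by (simp add: insertion_scale[OF P(1)] psubst_eq_insertion insertion_psubst[OF cst_hom, unfolded psubst_eq_insertion])
  ultimately have "f dvd ?w k0 ^ k * P"
    by (simp add: insertion_scale[OF P(1)] insertion_id P(2) psubst_def[of _ 0])
  then show ?thesis
    using f k0 by (meson prime_elem_dvd_multD prime_elem_dvd_power)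
qed

section \<open>Graded pieces as vector spaces and their dimensions\<close>

interpretation upoly: vector_space "smult :: complex \<Rightarrow> complex poly \<Rightarrow> complex poly"
  by unfold_locales (simp_all add: smult_add_left smult_add_right)

interpretation cvec: vector_space "\<lambda>c (a :: 'i \<Rightarrow> 'v cpoly) i. cst c * a i"
  by unfold_locales (simp_all add: fun_eq_iff algebra_simps cst_add cst_mult)

abbreviation forms :: "nat \<Rightarrow> 3 cpoly set" where
  "forms k \<equiv> {g. homogeneous k g}"

abbreviation form_vecs :: "nat \<Rightarrow> (3 \<Rightarrow> 3 cpoly) set" where
  "form_vecs k \<equiv> {a. \<forall>i. homogeneous k (a i)}"

lemma subspace_forms: "cpoly.subspace (forms k)"
  by (auto simp: cpoly.subspace_def intro: homogeneous_add homogeneous_scale)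

lemma subspace_form_vecs: "cvec.subspace (form_vecs k)"
  by (auto simp: cvec.subspace_def intro: homogeneous_add homogeneous_scale)

lemma subspace_degree_le: "upoly.subspace {p. degree p \<le> n}"
  by (auto simp: upoly.subspace_def intro: degree_add_le order_trans[OF degree_smult_le])

lemma lookup_cst_mult_single:
  "Poly_Mapping.lookup (cst a * Poly_Mapping.single m 1) n = (if n = m then a else 0)"
  by (auto simp: cst_def mult_single lookup_single when_def)

lemma sum_fun_apply: "(sum g A) x = (\<Sum>y\<in>A. g y x)"
  by (induction A rule: infinite_finite_induct) auto

lemma dim_forms: "cpoly.dim (forms k) = (k + 2) choose 2"
  and fin_dim_forms: "cpoly.fin_dim (forms k)"
proof -
  let ?I = "{m :: 3 \<Rightarrow>\<^sub>0 nat. mdeg m = k}" and ?e = "\<lambda>m :: 3 \<Rightarrow>\<^sub>0 nat. Poly_Mapping.single m (1 :: complex)"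
  have "v = (\<Sum>m\<in>?I. cst (Poly_Mapping.lookup v m) * ?e m)" if "v \<in> forms k" for v
    by (rule poly_mapping_eqI)
      (use that card_mdeg(1)[of k] in \<open>auto simp: lookup_sum lookup_cst_mult_single sum.delta homogeneous_iff\<close>)
  moreover have "u m = 0" if "(\<Sum>m\<in>?I. cst (u m) * ?e m) = 0" "m \<in> ?I" for u m
  proof -
    have "Poly_Mapping.lookup (\<Sum>m\<in>?I. cst (u m) * ?e m) m = u m"
      using that(2) card_mdeg(1)[of k] by (simp add: lookup_sum lookup_cst_mult_single sum.delta)
    then show "u m = 0" using that(1) by simp
  qed
  ultimately have *: "cpoly.dim (forms k) = card ?I" "cpoly.fin_dim (forms k)"
    using cpoly.dim_eq_card_coordinates[of ?I ?e "forms k" "\<lambda>m v. Poly_Mapping.lookup v m"] card_mdeg(1)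
    by (auto simp: homogeneous_def)
  show "cpoly.dim (forms k) = (k + 2) choose 2" "cpoly.fin_dim (forms k)"
    using * by (simp_all add: card_mdeg(2))
qed

lemma dim_form_vecs: "cvec.dim (form_vecs k) = 3 * ((k + 2) choose 2)"
  and fin_dim_form_vecs: "cvec.fin_dim (form_vecs k)"
proof -
  let ?M = "{m :: 3 \<Rightarrow>\<^sub>0 nat. mdeg m = k}"
  let ?I = "(UNIV :: 3 set) \<times> ?M"
  let ?e = "\<lambda>(i, m) j. if j = i then Poly_Mapping.single m 1 else 0 :: 3 cpoly"
  have fin: "finite ?I"
    using card_mdeg(1) by simp
  have lookup: "Poly_Mapping.lookup ((\<Sum>x\<in>?I. (\<lambda>j. cst (u x) * ?e x j)) j) m = (if mdeg m = k then u (j, m) else 0)" for u j m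
  proof -
    have "Poly_Mapping.lookup (cst (u x) * ?e x j) m = (if x = (j, m) then u x else 0)" for x
      by (cases x) (auto simp: lookup_cst_mult_single)
    then show ?thesis
      using fin by (simp add: sum_fun_apply lookup_sum sum.delta del: finite_cartesian_product)
  qed
  have "a = (\<Sum>x\<in>?I. (\<lambda>j. cst (Poly_Mapping.lookup (a (fst x)) (snd x)) * ?e x j))" if "a \<in> form_vecs k" for a
  proof (rule ext, rule poly_mapping_eqI)
    fix i m
    show "Poly_Mapping.lookup (a i) m = Poly_Mapping.lookup ((\<Sum>x\<in>?I. (\<lambda>j. cst (Poly_Mapping.lookup (a (fst x)) (snd x)) * ?e x j)) i) m"
      unfolding lookup using that by (auto simp: homogeneous_iff)
  qed
  moreover have "u x = 0" if "(\<Sum>x\<in>?I. (\<lambda>j. cst (u x) * ?e x j)) = 0" "x \<in> ?I" for u x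
    using lookup[of u "fst x" "snd x"] that by auto
  moreover have "?e x \<in> form_vecs k" if "x \<in> ?I" for x
    using that by (auto simp: homogeneous_def split: if_splits)
  ultimately have *: "cvec.dim (form_vecs k) = card ?I" "cvec.fin_dim (form_vecs k)"
    using cvec.dim_eq_card_coordinates[OF fin, of ?e "form_vecs k" "\<lambda>x a. Poly_Mapping.lookup (a (fst x)) (snd x)"]
    by blast+
  show "cvec.dim (form_vecs k) = 3 * ((k + 2) choose 2)" "cvec.fin_dim (form_vecs k)"
    using * by (simp_all add: card_mdeg(2) card_cartesian_product)
qed

lemma dim_degree_le: "upoly.dim {p. degree p \<le> n} = n + 1"
  and fin_dim_degree_le: "upoly.fin_dim {p. degree p \<le> n}"
proof -
  have "v = (\<Sum>i\<in>{..n}. smult (coeff v i) (monom 1 i))" if "v \<in> {p. degree p \<le> n}" for v :: "complex poly"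
  proof -
    have "smult a (monom 1 i) = monom a i" for a :: complex and i
      by (simp add: smult_monom)
    then have "(\<Sum>i\<in>{..n}. smult (coeff v i) (monom 1 i)) = v"
      using poly_as_sum_of_monoms'[of v n] that by simp
    then show ?thesis by (rule sym)
  qed
  moreover have "u i = 0" if "(\<Sum>i\<in>{..n}. smult (u i) (monom 1 i)) = 0" "i \<in> {..n}" for u :: "nat \<Rightarrow> complex" and i
  proof -
    have "coeff (\<Sum>i\<in>{..n}. smult (u i) (monom 1 i)) i = u i"
      using that(2) by (simp add: coeff_sum if_distrib[of "\<lambda>t. _ * t"] sum.delta cong: if_cong)
    then show "u i = 0" using that(1) by simp
  qed
  moreover have "monom 1 i \<in> {p :: complex poly. degree p \<le> n}" if "i \<in> {..n}" for i
    using that by (simp add: degree_monom_eq)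
  ultimately have *: "upoly.dim {p. degree p \<le> n} = card {..n}" "upoly.fin_dim {p. degree p \<le> n}"
    using upoly.dim_eq_card_coordinates[of "{..n}" "monom 1" "{p. degree p \<le> n}" "\<lambda>i v. coeff v i"]
    by blast+
  show "upoly.dim {p. degree p \<le> n} = n + 1" "upoly.fin_dim {p. degree p \<le> n}"
    using * by simp_all
qed

section \<open>Nodes\<close>

lemma third_index:
  fixes i k :: 3
  assumes "i \<noteq> k"
  obtains j where "j \<noteq> i" "j \<noteq> k" "\<And>x. x = i \<or> x = j \<or> x = k"
    "\<And>g :: 3 \<Rightarrow> 'a::comm_monoid_add. sum g UNIV = g i + g j + g k"
proof -
  have "card (UNIV - {i, k}) = 1"
    using assms by (simp add: card_Diff_subset)
  then obtain j where j: "UNIV - {i, k} = {j}"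
    by (auto simp: card_1_singleton_iff)
  then have U: "UNIV = {i, j, k}" and ne: "j \<noteq> i" "j \<noteq> k"
    by auto
  have "sum g UNIV = g i + g j + g k" for g :: "3 \<Rightarrow> 'a"
    unfolding U using ne assms by (simp add: add.assoc)
  moreover have "x = i \<or> x = j \<or> x = k" for x
    using U by blast
  ultimately show ?thesis using that ne by blast
qed

lemma linear_form_eq:
  assumes "homogeneous 1 (L :: 'v::finite cpoly)"
  shows "L = (\<Sum>j\<in>UNIV. cst (Poly_Mapping.lookup L (Poly_Mapping.single j 1)) * X j)"
proof (rule poly_mapping_eqI)
  fix m
  have *: "Poly_Mapping.lookup (cst a * X j) m = (if m = Poly_Mapping.single j 1 then a else 0)" for a and j :: 'v
    by (auto simp: cst_def X_def mult_single lookup_single when_def)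
  show "Poly_Mapping.lookup L m = Poly_Mapping.lookup (\<Sum>j\<in>UNIV. cst (Poly_Mapping.lookup L (Poly_Mapping.single j 1)) * X j) m"
  proof (cases "mdeg m = 1")
    case True
    have "\<not> (\<forall>i. Poly_Mapping.lookup m i = 0)"
    proof
      assume "\<forall>i. Poly_Mapping.lookup m i = 0"
      then have "mdeg m = 0" by (simp add: mdeg_def)
      with True show False by simp
    qed
    then obtain i where i: "Poly_Mapping.lookup m i \<noteq> 0" by blast
    have "Poly_Mapping.lookup m i + (\<Sum>j\<in>UNIV - {i}. Poly_Mapping.lookup m j) = 1"
      using True by (simp add: mdeg_def sum.remove[of UNIV i, symmetric])
    then have mi: "Poly_Mapping.lookup m i = 1" and "(\<Sum>j\<in>UNIV - {i}. Poly_Mapping.lookup m j) = 0"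
      using i by arith+
    then have "Poly_Mapping.lookup m j = 0" if "j \<noteq> i" for j
      using that by (simp add: sum_eq_0_iff)
    with mi have m: "m = Poly_Mapping.single i 1"
      by (intro poly_mapping_eqI) (auto simp: lookup_single when_def)
    have "Poly_Mapping.single i (1::nat) = Poly_Mapping.single j 1 \<longleftrightarrow> j = i" for j
      by (metis lookup_single_eq lookup_single_not_eq zero_neq_one)
    then show ?thesis
      unfolding lookup_sum * unfolding m by (simp add: sum.delta del: One_nat_def)
  next
    case False
    then have "m \<noteq> Poly_Mapping.single j 1" for j by auto
    with False show ?thesis
      unfolding lookup_sum * using assms by (auto simp: homogeneous_iff)
  qed
qed

lemma eval_linear_form:
  assumes "homogeneous 1 (L :: 'v::finite cpoly)"
  shows "eval w L = (\<Sum>j\<in>UNIV. Poly_Mapping.lookup L (Poly_Mapping.single j 1) * w j)"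
  by (subst linear_form_eq[OF assms])
    (simp add: eval_eq_insertion insertion_simps[OF id_hom] insertion_cst[OF id_hom] insertion_X[OF id_hom])

text \<open>On a line through the origin, powers of the parameter separate the homogeneous
  components.\<close>

lemma coeff_insertion_line:
  "coeff (insertion (\<lambda>c. [:c:]) (\<lambda>j. [:0, w j:]) F) k = eval w (hcomp k F)"
proof (induction F rule: cpoly_single_induct)
  case (3 m a)
  have "[:0, c:] ^ n = monom (c ^ n) n" for c :: complex and n
    by (induction n) (simp_all add: monom_Suc one_pCons monom_0 smult_monom mult.commute flip: monom_Suc)
  then have "(\<Prod>j\<in>A. [:0, w j:] ^ Poly_Mapping.lookup m j) =
      monom (\<Prod>j\<in>A. w j ^ Poly_Mapping.lookup m j) (\<Sum>j\<in>A. Poly_Mapping.lookup m j)" for A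
    by (induction A rule: infinite_finite_induct) (simp_all add: mult_monom one_pCons monom_0)
  moreover have "homogeneous (mdeg m) (Poly_Mapping.single m a)"
    by (simp add: homogeneous_def)
  ultimately show ?case
    by (simp add: insertion_single[OF const_poly_hom] hcomp_homogeneous eval_eq_insertion
        insertion_single[OF id_hom] mdeg_def insertion_simps[OF id_hom])
qed (simp_all add: insertion_simps[OF const_poly_hom] hcomp_add eval_eq_insertion insertion_simps[OF id_hom])

lemma poly_insertion: "poly (insertion (\<lambda>c. [:c:]) u P) x = eval (\<lambda>i. poly (u i) x) P"
proof -
  have "comm_ring_hom (\<lambda>p :: complex poly. poly p x)"
    by unfold_locales auto
  from hom_insertion[OF const_poly_hom this] show ?thesis
    by (simp add: eval_eq_insertion id_def)
qed

abbreviation hessian :: "'v::finite cpoly \<Rightarrow> ('v \<Rightarrow> complex) \<Rightarrow> 'v \<Rightarrow> 'v \<Rightarrow> complex" where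
  "hessian f p j l \<equiv> eval p (pdiff j (pdiff l f))"

text \<open>Both sides are the second derivative at 0 of \<open>f\<close> along the line through
  \<open>p\<close> with direction \<open>w(i := 0)\<close>: the chart freezes coordinate
  \<open>i\<close>, and the factor 2 is the factorial in Taylor's formula.\<close>

lemma hessian_local_equation:
  "2 * eval w (hcomp 2 (local_equation i p f)) =
     (\<Sum>j\<in>UNIV. \<Sum>l\<in>UNIV. (w(i := 0)) j * (w(i := 0)) l * hessian f p j l)"
proof -
  let ?C = "\<lambda>c :: complex. [:c:]" and ?w = "w(i := 0)"
  let ?u = "\<lambda>j. [:p j, ?w j:]"
  have line: "insertion ?C (\<lambda>j. [:0, w j:]) (local_equation i p f) = insertion ?C ?u f"
    unfolding local_equation_def insertion_psubst[OF const_poly_hom]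
    by (rule arg_cong[where f = "\<lambda>u. insertion ?C u f"])
      (auto simp: fun_eq_iff insertion_cst[OF const_poly_hom] insertion_X[OF const_poly_hom] insertion_simps[OF const_poly_hom])
  have d: "pderiv (insertion ?C ?u g) = (\<Sum>j\<in>UNIV. smult (?w j) (insertion ?C ?u (pdiff j g)))" for g
    by (simp add: pderiv_insertion pderiv_pCons)
  have sm: "pderiv (\<Sum>l\<in>UNIV. g l) = (\<Sum>l\<in>UNIV. pderiv (g l))" for g :: "3 \<Rightarrow> complex poly"
    by (simp add: sum_3 pderiv_add)
  have "2 * coeff (insertion ?C ?u f) 2 = coeff (pderiv (pderiv (insertion ?C ?u f))) 0"
    by (simp add: coeff_pderiv numeral_2_eq_2)
  also have "\<dots> = poly (pderiv (pderiv (insertion ?C ?u f))) 0"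
    by (simp add: poly_0_coeff_0)
  also have "\<dots> = (\<Sum>l\<in>UNIV. \<Sum>j\<in>UNIV. ?w l * (?w j * hessian f p j l))"
    by (simp add: d sm pderiv_smult poly_sum poly_insertion sum_distrib_left del: fun_upd_apply)
  also have "\<dots> = (\<Sum>j\<in>UNIV. \<Sum>l\<in>UNIV. ?w j * ?w l * hessian f p j l)"
    by (subst sum.swap) (simp add: mult_ac del: fun_upd_apply)
  finally show ?thesis
    unfolding coeff_insertion_line[symmetric] line .
qed

text \<open>In the chart the quadratic form of the Hessian is twice the product of two independent
  linear forms, so its radical is their common zero. The condition \<open>v i = 0\<close> selects
  chart directions; on the whole space the vector \<open>p\<close> itself lies in the kernel, by
  Euler's formula for the partial derivatives.\<close>

lemma hessian_kernel_at_node: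
  assumes "node f p"
  obtains i where "p i \<noteq> 0"
    "\<And>v j. v i = 0 \<Longrightarrow> (\<And>l. (\<Sum>j\<in>UNIV. v j * hessian f p j l) = 0) \<Longrightarrow> v j = 0"
proof -
  from assms obtain i L1 L2 where i: "p i \<noteq> 0" and L: "homogeneous 1 L1" "homogeneous 1 L2"
    and ind: "\<And>a b. cst a * L1 + cst b * L2 = 0 \<Longrightarrow> a = 0 \<and> b = 0"
    and eq: "hcomp 2 (local_equation i p f) = L1 * L2"
    unfolding node_def by blast
  define c1 c2 where c: "c1 = (\<lambda>j. Poly_Mapping.lookup L1 (Poly_Mapping.single j 1))"
    "c2 = (\<lambda>j. Poly_Mapping.lookup L2 (Poly_Mapping.single j 1))"
  define l1 l2 where l: "l1 = (\<lambda>w. \<Sum>j\<in>UNIV. c1 j * w j)" "l2 = (\<lambda>w. \<Sum>j\<in>UNIV. c2 j * w j)"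
  have ind': "a = 0 \<and> b = 0" if "\<And>j. a * c1 j + b * c2 j = 0" for a b
  proof (rule ind)
    have "cst a * L1 + cst b * L2 = (\<Sum>j\<in>UNIV. cst (a * c1 j + b * c2 j) * X j)"
      by (subst linear_form_eq[OF L(1)], subst linear_form_eq[OF L(2)])
        (simp add: c sum_distrib_left sum.distrib cst_add cst_mult algebra_simps)
    then show "cst a * L1 + cst b * L2 = 0" using that by simp
  qed
  let ?H = "hessian f p"
  have Q: "2 * (l1 w * l2 w) = (\<Sum>j\<in>UNIV. \<Sum>l\<in>UNIV. (w(i := 0)) j * (w(i := 0)) l * ?H j l)" for w
    unfolding hessian_local_equation[symmetric] eq
    by (simp add: eval_eq_insertion insertion_simps[OF id_hom] l c
        eval_linear_form[OF L(1), unfolded eval_eq_insertion] eval_linear_form[OF L(2), unfolded eval_eq_insertion])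
  \<comment> \<open>Translation by a radical vector \<open>x\<close> leaves the product
    \<open>l1 * l2\<close> unchanged. The mixed terms give a linear relation between the two forms
    with coefficients \<open>l2 x\<close> and \<open>l1 x\<close>, and independence makes both
    0.\<close>
  have radical: "l1 x = 0 \<and> l2 x = 0" if x: "\<And>l. (\<Sum>j\<in>UNIV. (x(i := 0)) j * ?H j l) = 0" for x
  proof -
    have x': "(\<Sum>l\<in>UNIV. (x(i := 0)) l * ?H j l) = 0" for j
      using x[of j] pdiff_commute[of _ j f] by simp
    have inv: "l1 (\<lambda>j. w j + x j) * l2 (\<lambda>j. w j + x j) = l1 w * l2 w" for w
    proof -
      let ?w = "w(i := 0)" and ?x = "x(i := 0)"
      have "2 * (l1 (\<lambda>j. w j + x j) * l2 (\<lambda>j. w j + x j)) =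
          (\<Sum>j\<in>UNIV. \<Sum>l\<in>UNIV. (?w j + ?x j) * (?w l + ?x l) * ?H j l)"
        unfolding Q by (intro sum.cong refl) auto
      also have "\<dots> = (\<Sum>j\<in>UNIV. \<Sum>l\<in>UNIV. ?w j * ?w l * ?H j l) +
          (\<Sum>j\<in>UNIV. ?w j * (\<Sum>l\<in>UNIV. ?x l * ?H j l)) +
          (\<Sum>l\<in>UNIV. (?w l + ?x l) * (\<Sum>j\<in>UNIV. ?x j * ?H j l))"
        by (simp only: sum_3) (simp add: algebra_simps del: fun_upd_apply)
      also have "\<dots> = 2 * (l1 w * l2 w)"
        unfolding x x' Q by simp
      finally show ?thesis by simp
    qed
    have add: "l1 (\<lambda>j. w j + x j) = l1 w + l1 x" "l2 (\<lambda>j. w j + x j) = l2 w + l2 x" for w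
      by (simp_all add: l sum.distrib algebra_simps)
    have "l1 x * l2 x = 0"
      using inv[of "\<lambda>_. 0"] by (simp add: l)
    then have "l2 x * l1 w + l1 x * l2 w = 0" for w
      using inv[of w] unfolding add by algebra
    from this[of "\<lambda>j. if j = k then 1 else 0" for k] have "l2 x * c1 k + l1 x * c2 k = 0" for k
      by (simp add: l if_distrib[of "\<lambda>t. _ * t"] sum.delta cong: if_cong)
    from ind'[OF this] show ?thesis by simp
  qed
  \<comment> \<open>The local equation does not involve variable \<open>i\<close>: its unit vector
    becomes 0 after the update, hence is radical.\<close>
  have ci: "c1 i = 0" "c2 i = 0"
  proof -
    have "(\<lambda>j. if j = i then 1 else 0)(i := 0) = (\<lambda>j. 0 :: complex)" by auto
    from radical[of "\<lambda>j. if j = i then 1 else 0", unfolded this] show "c1 i = 0" "c2 i = 0"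
      by (simp_all add: l if_distrib[of "\<lambda>t. _ * t"] sum.delta cong: if_cong)
  qed
  have "v k = 0" if v: "v i = 0" "\<And>l. (\<Sum>j\<in>UNIV. v j * ?H j l) = 0" for v k
  proof (rule ccontr)
    assume k: "v k \<noteq> 0"
    have "v(i := 0) = v" using v by auto
    with radical[of v] v have r: "l1 v = 0" "l2 v = 0" by simp_all
    from k v have "i \<noteq> k" by blast
    then obtain j where j: "j \<noteq> i" "j \<noteq> k" "\<And>x. x = i \<or> x = j \<or> x = k"
      and s: "\<And>g :: 3 \<Rightarrow> complex. sum g UNIV = g i + g j + g k"
      using third_index by blast
    have r': "c1 j * v j + c1 k * v k = 0" "c2 j * v j + c2 k * v k = 0"
      using r ci by (simp_all add: l s)
    \<comment> \<open>Cramer's rule in the coordinates \<open>j\<close> and \<open>k\<close>: a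
      non-zero solution forces the determinant to vanish, which contradicts the independence of the
      two forms.\<close>
    have "(c2 j * c1 k - c1 j * c2 k) * v k = c2 j * (c1 j * v j + c1 k * v k) - c1 j * (c2 j * v j + c2 k * v k)"
      by (simp add: algebra_simps)
    then have "c2 j * c1 k - c1 j * c2 k = 0"
      using r' k by simp
    then have "c2 j * c1 x + (- c1 j) * c2 x = 0" for x
      using j(3)[of x] ci by (auto simp: algebra_simps)
    from ind'[OF this] have "c1 j = 0" "c2 j = 0" by auto
    with r' k have "c1 k = 0" by simp
    then have "1 * c1 x + 0 * c2 x = 0" for x
      using j(3)[of x] ci \<open>c1 j = 0\<close> by auto
    from ind'[OF this] show False by simp
  qed
  with i that show ?thesis by blast
qed

text \<open>Differentiating the syzygy relation at a singular point leaves only second derivatives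
  of \<open>f\<close>, so the value of \<open>a\<close> lies in the kernel of the Hessian. By
  Euler's formula so does \<open>p\<close>. The combination of the two with coordinate
  \<open>n\<close> equal to 0 must then vanish.\<close>

lemma AR_at_node:
  assumes node: "node f p" and f: "homogeneous d f" and sing: "\<And>l. eval p (pdiff l f) = 0"
    and a: "a \<in> AR f"
  shows "p i * eval p (a j) = p j * eval p (a i)"
proof -
  obtain n where n: "p n \<noteq> 0"
    and ker: "\<And>v j. v n = 0 \<Longrightarrow> (\<And>l. (\<Sum>j\<in>UNIV. v j * hessian f p j l) = 0) \<Longrightarrow> v j = 0"
    using hessian_kernel_at_node[OF node] by metis
  note ev = eval_eq_insertion insertion_simps[OF id_hom] insertion_X[OF id_hom]
  have *: "(\<Sum>j\<in>UNIV. p j * hessian f p j l) = 0" for l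
  proof -
    have "homogeneous (d - 1) (pdiff l f)" by (rule homogeneous_pdiff[OF f])
    from arg_cong[OF euler[OF this], of "eval p"] show ?thesis
      using sing[of l] by (simp add: ev)
  qed
  have **: "(\<Sum>j\<in>UNIV. eval p (a j) * hessian f p j l) = 0" for l
  proof -
    have "(\<Sum>j\<in>UNIV. a j * pdiff j f) = 0" using a by (simp add: AR_def)
    from arg_cong[OF arg_cong[OF this, of "pdiff l"], of "eval p"] show ?thesis
      using sing by (simp add: ev pdiff_sum pdiff_mult sum.distrib pdiff_commute[of l])
  qed
  let ?v = "\<lambda>j. p n * eval p (a j) - eval p (a n) * p j"
  have "(\<Sum>j\<in>UNIV. ?v j * hessian f p j l) = 0" for l
    using *[of l] **[of l] unfolding sum_3 by algebra
  from ker[of ?v, OF _ this] have "p n * eval p (a j) = eval p (a n) * p j" for j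
    by simp
  from this[of i] this[of j] have "p n * (p i * eval p (a j)) = p n * (p j * eval p (a i))"
    by algebra
  then show ?thesis using n by simp
qed

text \<open>Polynomials in one variable form a principal ideal domain, so the content can be divided
  out. The Bezout relation records that the quotients have no common zero; this is used for the
  parametrization, for the gradient and for the displacement from a node.\<close>

lemma unimodular_factor:
  fixes v :: "3 \<Rightarrow> complex poly"
  assumes "\<exists>i. v i \<noteq> 0"
  obtains g w c where "g \<noteq> 0" "\<And>i. v i = g * w i" "(\<Sum>i\<in>UNIV. c i * w i) = 1"
proof -
  define h where "h = gcd (v 0) (v 1)"
  define g where "g = gcd h (v 2)"
  have "g \<noteq> 0"
    using assms unfolding g_def h_def exists_3 by auto
  obtain a b where ab: "a * v 0 + b * v 1 = h"
    unfolding h_def using bezout_coefficients_fst_snd by blast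
  obtain a' b' where ab': "a' * h + b' * v 2 = g"
    unfolding g_def using bezout_coefficients_fst_snd by blast
  have "g dvd v 0" "g dvd v 1" "g dvd v 2"
    unfolding g_def h_def by (meson dvd_trans gcd_dvd1 gcd_dvd2)+
  then have "\<forall>i. g dvd v i" by (simp add: forall_3)
  then have "\<forall>i. \<exists>t. v i = g * t" by (simp add: dvd_def)
  then obtain w where w: "\<And>i. v i = g * w i"
    by metis
  let ?c = "\<lambda>i :: 3. if i = 0 then a' * a else if i = 1 then a' * b else b'"
  have "g * (\<Sum>i\<in>UNIV. ?c i * w i) = a' * (a * v 0 + b * v 1) + b' * v 2"
    by (simp add: sum_3 w algebra_simps)
  then have "g * (\<Sum>i\<in>UNIV. ?c i * w i) = g * 1"
    by (simp only: ab ab' mult_1_right)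
  then have "(\<Sum>i\<in>UNIV. ?c i * w i) = 1"
    using \<open>g \<noteq> 0\<close> by (simp only: mult_cancel_left) simp
  with \<open>g \<noteq> 0\<close> w show ?thesis by (rule that)
qed

text \<open>
  If \<open>u - p\<close> vanishes to order \<open>k\<close> at \<open>x\<close> (in an affine chart), so does every form
  vanishing at the node \<open>p\<close>. The gradient of \<open>f\<close> vanishes to order exactly \<open>k\<close>, because the
  Hessian is nondegenerate in the chart.
\<close>

lemma power_dvd_at_node:
  fixes u :: "3 \<Rightarrow> complex poly" and x :: complex
  defines "p \<equiv> \<lambda>i. poly (u i) x" and "ev \<equiv> insertion (\<lambda>c. [:c:]) u"
  assumes node: "node f p" and f: "homogeneous d f" "2 \<le> d"
    and sing: "\<And>l. eval p (pdiff l f) = 0"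
    and nonlinear: "\<And>P. homogeneous 1 P \<Longrightarrow> ev P = 0 \<Longrightarrow> P = 0"
    and dvd: "\<And>l. [:- x, 1:] ^ n dvd ev (pdiff l f)"
    and h: "homogeneous k h" "eval p h = 0"
  shows "[:- x, 1:] ^ n dvd ev h"
proof -
  let ?C = "\<lambda>c :: complex. [:c:]"
  obtain i where i: "p i \<noteq> 0"
    and ker: "\<And>v j. v i = 0 \<Longrightarrow> (\<And>l. (\<Sum>j\<in>UNIV. v j * hessian f p j l) = 0) \<Longrightarrow> v j = 0"
    using hessian_kernel_at_node[OF node] by metis
  \<comment> \<open>The displacement of \<open>u\<close> from \<open>p\<close> in the chart
    \<open>i\<close>, cleared of denominators; its coordinate \<open>i\<close> is 0.\<close>
  define v where "v = (\<lambda>j. smult (p i) (u j) - smult (p j) (u i))"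
  \<comment> \<open>Otherwise the curve would lie on a line, against
    \<open>nonlinear\<close>.\<close>
  have "\<exists>j. v j \<noteq> 0"
  proof (rule ccontr)
    assume v0: "\<nexists>j. v j \<noteq> 0"
    obtain j where j: "j \<noteq> i" by (metis (full_types) zero_neq_one)
    let ?P = "cst (p i) * X j - cst (p j) * X i"
    have "homogeneous 1 ?P"
      by (intro homogeneous_diff homogeneous_scale homogeneous_X)
    moreover have "ev ?P = v j"
      by (simp add: ev_def v_def insertion_simps[OF const_poly_hom] insertion_X[OF const_poly_hom] insertion_cst[OF const_poly_hom])
    ultimately have "?P = 0" using v0 by (intro nonlinear) simp_all
    then have "pdiff j ?P = 0" by simp
    then show False
      using i j by (simp add: pdiff_diff pdiff_mult pdiff_X)
  qed
  then obtain g w c where g: "g \<noteq> 0" and w: "\<And>j. v j = g * w j" and cw: "(\<Sum>j\<in>UNIV. c j * w j) = 1"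
    using unimodular_factor by metis
  \<comment> \<open>The exact power of the local parameter at \<open>x\<close> that divides the
    displacement.\<close>
  define y where "y = [:- x, 1:] ^ order x g"
  obtain g' where g': "g = y * g'" "poly g' x \<noteq> 0"
    using order_decomp[OF g, of x] by (auto simp: y_def poly_eq_0_iff_dvd)
  have "v i = 0" by (simp add: v_def)
  with w g have wi: "w i = 0" by (metis mult_eq_0_iff)
  have wx: "\<exists>j. poly (w j) x \<noteq> 0"
  proof (rule ccontr)
    assume "\<nexists>j. poly (w j) x \<noteq> 0"
    then have "poly (\<Sum>j\<in>UNIV. c j * w j) x = 0" by (simp add: poly_sum)
    then show False unfolding cw by simp
  qed
  have "poly g x = 0"
  proof -
    obtain j where "poly (w j) x \<noteq> 0" using wx by blast
    moreover have "poly (v j) x = 0" by (simp add: v_def p_def)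
    ultimately show ?thesis using w by simp
  qed
  then have xy: "[:- x, 1:] dvd y"
    using g by (simp add: y_def order_root dvd_power)
  have y_dvd: "y dvd v j" for j
    by (simp add: w g')
  have taylor: "y ^ 2 dvd smult (p i ^ m) (ev P) - smult (eval p P) (u i ^ m) -
      (\<Sum>j\<in>UNIV. v j * smult (eval p (pdiff j P)) (u i ^ (m - 1)))" if P: "homogeneous m P" for P m
  proof -
    \<comment> \<open>The chart relation without denominators: \<open>u i\<close> times
      \<open>p\<close>, displaced by \<open>v\<close>, is \<open>p i\<close> times \<open>u\<close>.
      Homogeneity then removes the scalars.\<close>
    have pi: "(\<lambda>j. u i * [:p j:] + v j) = (\<lambda>j. [:p i:] * u j)"
      by (auto simp: v_def fun_eq_iff mult.commute)
    have cp: "insertion ?C (\<lambda>j. u i * [:p j:]) Q = smult (eval p Q) (u i ^ q)" if Q: "homogeneous q Q" for Q q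
    proof -
      have "insertion ?C (\<lambda>j. [:p j:]) Q = [:eval p Q:]"
        using hom_insertion[OF id_hom const_poly_hom, of p Q] by (simp add: eval_eq_insertion)
      then show ?thesis
        by (simp only: insertion_scale[OF Q, of ?C "u i" "\<lambda>j. [:p j:]"]) simp
    qed
    have pu: "insertion ?C (\<lambda>j. [:p i:] * u j) P = smult (p i ^ m) (ev P)"
      by (simp only: insertion_scale[OF P] const_poly_power ev_def) simp
    from insertion_taylor[OF const_poly_hom, of y v "\<lambda>j. u i * [:p j:]" P, OF y_dvd] show ?thesis
      unfolding pi pu cp[OF P] cp[OF homogeneous_pdiff[OF P]] .
  qed
  \<comment> \<open>The constant Taylor term vanishes with \<open>eval p h\<close>, and the linear
    term is divisible by \<open>y\<close>.\<close>
  have y_h: "y dvd ev h"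
  proof -
    have "y dvd smult (p i ^ k) (ev h) - (\<Sum>j\<in>UNIV. v j * smult (eval p (pdiff j h)) (u i ^ (k - 1)))"
      using taylor[OF h(1)] h(2) by (simp add: power2_eq_square) (meson dvd_mult_left)
    moreover have "y dvd (\<Sum>j\<in>UNIV. v j * smult (eval p (pdiff j h)) (u i ^ (k - 1)))"
      by (intro dvd_sum dvd_mult2 y_dvd)
    ultimately have "y dvd smult (p i ^ k) (ev h)"
      by (simp add: dvd_diff_left_iff)
    then show ?thesis using i by (simp add: dvd_smult_iff)
  qed
  \<comment> \<open>If the gradient vanished to higher order than the displacement, then dividing
    its Taylor expansion by \<open>y\<close> and evaluating at \<open>x\<close> would put the
    non-zero chart vector \<open>w\<close> at \<open>x\<close> into the kernel of the
    Hessian.\<close>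
  have "n \<le> order x g"
  proof (rule ccontr)
    assume "\<not> n \<le> order x g"
    then have "[:- x, 1:] ^ Suc (order x g) dvd [:- x, 1:] ^ n"
      by (intro le_imp_power_dvd) simp
    then have yl: "[:- x, 1:] * y dvd ev (pdiff l f)" for l
      using dvd[of l] by (simp add: y_def) (meson dvd_trans)
    have "(\<Sum>j\<in>UNIV. poly (w j) x * hessian f p j l) = 0" for l
    proof -
      let ?s = "\<Sum>j\<in>UNIV. w j * [:hessian f p j l:]"
      have "[:- x, 1:] * y dvd y ^ 2"
        unfolding power2_eq_square using xy by (intro mult_dvd_mono) simp_all
      then have "[:- x, 1:] * y dvd smult (p i ^ (d - 1)) (ev (pdiff l f)) -
          (\<Sum>j\<in>UNIV. v j * smult (hessian f p j l) (u i ^ (d - 1 - 1)))"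
        using dvd_trans[OF _ taylor[OF homogeneous_pdiff[OF f(1), of l]]] by (simp only: sing smult_0_left diff_zero)
      moreover have "[:- x, 1:] * y dvd smult (p i ^ (d - 1)) (ev (pdiff l f))"
        using yl by (rule dvd_smult)
      ultimately have "[:- x, 1:] * y dvd (\<Sum>j\<in>UNIV. v j * smult (hessian f p j l) (u i ^ (d - 1 - 1)))"
        by (simp add: dvd_diff_right_iff)
      also have "(\<Sum>j\<in>UNIV. v j * smult (hessian f p j l) (u i ^ (d - 1 - 1))) = y * (g' * u i ^ (d - 1 - 1) * ?s)"
        by (simp add: w g' sum_distrib_left mult_ac)
      finally have "[:- x, 1:] dvd g' * u i ^ (d - 1 - 1) * ?s"
        using g g'(1) by (simp only: mult.commute[of _ y] dvd_mult_cancel_left mult_eq_0_iff) blast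
      then have "poly (g' * u i ^ (d - 1 - 1) * ?s) x = 0"
        by (simp only: poly_eq_0_iff_dvd)
      then have "poly ?s x = 0"
        using g'(2) i by (simp add: p_def)
      then show ?thesis by (simp add: poly_sum mult.commute)
    qed
    from ker[OF _ this] wi wx show False by simp
  qed
  then have "[:- x, 1:] ^ n dvd y"
    unfolding y_def by (rule le_imp_power_dvd)
  then show ?thesis using y_h by (rule dvd_trans)
qed

section \<open>The parametrized curve\<close>

lemma coeff_linear_power': "coeff ([:a, b:] ^ n) n = (b :: 'a::comm_ring_1) ^ n"
proof (induction n)
  case (Suc n)
  have "degree ([:a, b:] ^ n) \<le> n"
    by (rule order_trans[OF degree_power_le]) simp
  then have "coeff ([:a, b:] ^ n) (Suc n) = 0"
    by (simp add: coeff_eq_0)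
  then show ?case
    using Suc by (simp add: coeff_pCons)
qed simp

text \<open>
  Dehomogenization in a coordinate of the line in which the point \<open>(a : 1)\<close> is at infinity.
\<close>

definition dehom :: "complex \<Rightarrow> 2 cpoly \<Rightarrow> complex poly" where
  "dehom a = insertion (\<lambda>c. [:c:]) (\<lambda>j. if j = 0 then [:1, a:] else [:0, 1:])"

lemma dehom_form:
  assumes "homogeneous M h"
  shows "dehom a h = (\<Sum>i\<le>M. smult (Poly_Mapping.lookup h (Poly_Mapping.single 0 i + Poly_Mapping.single 1 (M - i)))
    ([:1, a:] ^ i * [:0, 1:] ^ (M - i)))"
  by (simp add: dehom_def insertion_binary_form[OF assms const_poly_hom])

text \<open>Evaluation at 0 isolates the last coefficient, since all other terms contain the factor
  \<open>[:0, 1:]\<close>; dividing by that factor lowers \<open>M\<close>.\<close>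

lemma binary_powers_independent:
  assumes "(\<Sum>i\<le>M. smult (c i) ([:1, a:] ^ i * [:0, 1:] ^ (M - i))) = (0 :: complex poly)" "i \<le> M"
  shows "c i = 0"
  using assms
proof (induction M arbitrary: i)
  case 0
  then show ?case by (simp add: one_pCons)
next
  case (Suc M)
  have split: "(\<Sum>i\<le>Suc M. smult (c i) ([:1, a:] ^ i * [:0, 1:] ^ (Suc M - i))) =
      [:0, 1:] * (\<Sum>i\<le>M. smult (c i) ([:1, a:] ^ i * [:0, 1:] ^ (M - i))) + smult (c (Suc M)) ([:1, a:] ^ Suc M)"
    unfolding sum_distrib_left by (simp add: Suc_diff_le mult_ac del: power_Suc) (simp add: mult_ac)
  have "poly (\<Sum>i\<le>Suc M. smult (c i) ([:1, a:] ^ i * [:0, 1:] ^ (Suc M - i))) 0 = 0"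
    unfolding Suc.prems(1) by simp
  then have c: "c (Suc M) = 0"
    unfolding split by simp
  with Suc.prems(1) have "(\<Sum>i\<le>M. smult (c i) ([:1, a:] ^ i * [:0, 1:] ^ (M - i))) = 0"
    unfolding split by simp
  then show ?case
    using Suc.IH Suc.prems(2) c by (cases "i = Suc M") auto
qed

lemma dehom_eq_0:
  assumes "homogeneous M h" "dehom a h = 0"
  shows "h = 0"
  using assms(2) unfolding dehom_form[OF assms(1)]
  by (intro homogeneous_binary_eq_0[OF assms(1)]) (rule binary_powers_independent)

text \<open>The coefficient in degree \<open>M\<close> is the value of \<open>h\<close> at (a : 1),
  which is a non-zero polynomial in \<open>a\<close>. Hence a point at infinity where
  \<open>h\<close> does not vanish can be chosen.\<close>

lemma degree_dehom:
  assumes h: "homogeneous M h" "h \<noteq> 0"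
  shows "degree (dehom a h) \<le> M"
    and "\<exists>a. coeff (dehom a h) M \<noteq> 0"
proof -
  have "degree (dehom a h) \<le> 1 * M"
    unfolding dehom_def by (rule degree_insertion_le[OF _ h(1)]) auto
  then show "degree (dehom a h) \<le> M" by simp
  let ?c = "\<lambda>i. Poly_Mapping.lookup h (Poly_Mapping.single 0 i + Poly_Mapping.single 1 (M - i))"
  let ?p = "\<Sum>i\<le>M. monom (?c i) i"
  have "coeff (dehom a h) M = poly ?p a" for a
  proof -
    have "coeff ([:1, a:] ^ i * [:0, 1:] ^ (M - i)) M = a ^ i" if "i \<le> M" for i
      using that by (simp add: X_poly_power mult.commute[of _ "monom 1 _"] coeff_monom_mult coeff_linear_power')
    then show ?thesis
      by (simp add: dehom_form[OF h(1)] coeff_sum poly_sum poly_monom)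
  qed
  moreover have "?p \<noteq> 0"
  proof
    assume "?p = 0"
    then have "coeff ?p i = 0" for i by simp
    then have "?c i = 0" if "i \<le> M" for i
      using that by (auto simp: coeff_sum sum.delta dest!: meta_spec[of _ i])
    then show False using h homogeneous_binary_eq_0 by blast
  qed
  then have "\<exists>a. poly ?p a \<noteq> 0"
    using poly_all_0_iff_0[of ?p] by blast
  ultimately show "\<exists>a. coeff (dehom a h) M \<noteq> 0"
    by simp
qed

text \<open>The rational map \<phi> is dehomogenized and divided by its content. The factor \<mu>
  measures how far the pullback of \<psi> is from the coordinates \<open>[:1, a:]\<close> and
  \<open>[:0, 1:]\<close> of the line, to which it is only proportional.\<close>

lemma rational_curve_parametrization:
  assumes f: "homogeneous d f" "2 \<le> d" "irreducible f" and rat: "rational_curve f"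
  obtains u :: "3 \<Rightarrow> complex poly" and c m l and \<psi> :: "2 \<Rightarrow> 3 cpoly" and e \<mu> a
  where "\<And>P k. homogeneous k P \<Longrightarrow> insertion (\<lambda>c. [:c:]) u P = 0 \<Longrightarrow> f dvd P"
    "insertion (\<lambda>c. [:c:]) u f = 0"
    "(\<Sum>i\<in>UNIV. c i * u i) = 1"
    "\<And>i. degree (u i) \<le> m"
    "insertion (\<lambda>c. [:c:]) u (pdiff l f) \<noteq> 0"
    "degree (insertion (\<lambda>c. [:c:]) u (pdiff l f)) = m * (d - 1)"
    "\<And>j. homogeneous e (\<psi> j)"
    "insertion (\<lambda>c. [:c:]) u (\<psi> 0) = \<mu> * [:1, a:]" "insertion (\<lambda>c. [:c:]) u (\<psi> 1) = \<mu> * [:0, 1:]" "\<mu> \<noteq> 0"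
proof -
  let ?ins = "insertion (\<lambda>c. [:c:])"
  note hom_simps = insertion_simps[OF const_poly_hom] insertion_X[OF const_poly_hom]
  from rat obtain \<phi> :: "3 \<Rightarrow> 2 cpoly" and \<psi> :: "2 \<Rightarrow> 3 cpoly" and M e where
    \<phi>: "\<And>i. homogeneous M (\<phi> i)" and \<phi>f: "psubst \<phi> f = 0" and \<psi>: "\<And>j. homogeneous e (\<psi> j)"
    and \<psi>0: "\<exists>j. psubst \<phi> (\<psi> j) \<noteq> 0"
    and inv: "\<And>j k. X j * psubst \<phi> (\<psi> k) = X k * psubst \<phi> (\<psi> j)"
    and \<psi>\<phi>: "\<exists>i. \<not> f dvd psubst \<psi> (\<phi> i)"
    and inv': "\<And>i k. f dvd X i * psubst \<psi> (\<phi> k) - X k * psubst \<psi> (\<phi> i)"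
    unfolding rational_curve_def by blast
  have prime: "prime_elem f"
    by (rule irreducible_imp_prime_elem_cpoly[OF f(3)])
  then have "f \<noteq> 0" by auto
  have ker: "f dvd P" if "homogeneous k P" "psubst \<phi> P = 0" for P k
    using dvd_of_psubst_eq_0[OF prime that inv'] \<psi>\<phi> by blast
  have "\<exists>l. pdiff l f \<noteq> 0"
  proof (rule ccontr)
    assume "\<nexists>l. pdiff l f \<noteq> 0"
    with euler[OF f(1)] have "of_nat d * f = 0" by simp
    then show False using \<open>f \<noteq> 0\<close> f(2) by simp
  qed
  then obtain l where l: "pdiff l f \<noteq> 0" ..
  have pl: "homogeneous (d - 1) (pdiff l f)" by (rule homogeneous_pdiff[OF f(1)])
  define h where "h = psubst \<phi> (pdiff l f)"
  have h: "homogeneous (M * (d - 1)) h"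
    unfolding h_def by (rule homogeneous_psubst[OF \<phi> pl])
  have "h \<noteq> 0"
  proof
    assume "h = 0"
    then have "f dvd pdiff l f" using ker[OF pl] by (simp add: h_def)
    then show False
      by (rule homogeneous_dvdE[OF f(1) pl _ l]) (use f(2) in simp)
  qed
  \<comment> \<open>This choice keeps the point at infinity away from the common zeros of the
    gradient, so that none of them is lost.\<close>
  then obtain a where a: "coeff (dehom a h) (M * (d - 1)) \<noteq> 0" and "degree (dehom a h) \<le> M * (d - 1)"
    using degree_dehom[OF h] by blast
  then have deg_h: "degree (dehom a h) = M * (d - 1)"
    by (simp add: le_degree order_antisym)
  define U where "U = (\<lambda>i. dehom a (\<phi> i))"
  have dehom_psubst: "dehom a (psubst \<phi> P) = ?ins U P" for P
    unfolding dehom_def U_def by (rule insertion_psubst[OF const_poly_hom])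
  have hU: "dehom a h = ?ins U (pdiff l f)"
    unfolding h_def by (rule dehom_psubst)
  have "\<exists>i. U i \<noteq> 0"
  proof (rule ccontr)
    assume "\<nexists>i. U i \<noteq> 0"
    then have "U = (\<lambda>i. 0 * U i)" by auto
    then have "?ins U (pdiff l f) = 0 ^ (d - 1) * ?ins U (pdiff l f)"
      by (metis insertion_scale[OF pl])
    then show False using a f(2) hU by (simp add: power_0_left)
  qed
  then obtain g u c where g: "g \<noteq> 0" and u: "\<And>i. U i = g * u i" and c: "(\<Sum>i\<in>UNIV. c i * u i) = 1"
    using unimodular_factor by metis
  have "U = (\<lambda>i. g * u i)" by (rule ext) (rule u)
  then have insU: "?ins U P = g ^ k * ?ins u P" if "homogeneous k P" for P k
    by (simp only: insertion_scale[OF that])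
  have degU: "degree (U i) \<le> M" for i
  proof -
    have "degree (U i) \<le> 1 * M"
      unfolding U_def dehom_def by (rule degree_insertion_le[OF _ \<phi>]) auto
    then show ?thesis by simp
  qed
  have degg: "degree g \<le> M"
  proof -
    obtain i where "U i \<noteq> 0" using \<open>\<exists>i. U i \<noteq> 0\<close> by blast
    then have "u i \<noteq> 0" using u by auto
    then show ?thesis using degU[of i] g by (simp add: u degree_mult_eq)
  qed
  have ker0: "psubst \<phi> P = 0" if P: "homogeneous k P" "?ins u P = 0" for P k
  proof (rule dehom_eq_0[OF homogeneous_psubst[OF \<phi> P(1)]])
    show "dehom a (psubst \<phi> P) = 0"
      unfolding dehom_psubst insU[OF P(1)] using P(2) by simp
  qed
  define A where "A = (\<lambda>j. ?ins u (\<psi> j))"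
  \<comment> \<open>The pullback of \<psi> is proportional to the coordinates of the line because
    the composite of \<psi> and \<phi> is the identity. Since \<open>[:0, 1:]\<close> and
    \<open>[:1, a:]\<close> are coprime, a common factor \<mu> can then be split off.\<close>
  have "[:1, a:] * A 1 = [:0, 1:] * A 0"
  proof -
    have "dehom a (X 0 * psubst \<phi> (\<psi> 1)) = dehom a (X 1 * psubst \<phi> (\<psi> 0))"
      by (simp only: inv)
    then have "[:1, a:] * dehom a (psubst \<phi> (\<psi> 1)) = [:0, 1:] * dehom a (psubst \<phi> (\<psi> 0))"
      by (simp only: dehom_def hom_simps) simp
    then have "g ^ e * ([:1, a:] * A 1) = g ^ e * ([:0, 1:] * A 0)"
      unfolding dehom_psubst insU[OF \<psi>] A_def by (simp only: mult_ac)
    then show ?thesis using g by (simp only: mult_cancel_left power_eq_0_iff) blast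
  qed
  note A = this
  then have "poly ([:1, a:] * A 1) 0 = 0" by simp
  then have "poly (A 1) 0 = 0" by simp
  then obtain \<mu> where \<mu>: "A 1 = [:0, 1:] * \<mu>"
    by (metis dvdE minus_zero poly_eq_0_iff_dvd)
  with A have "[:0, 1:] * (\<mu> * [:1, a:]) = [:0, 1:] * A 0"
    by (metis mult.assoc mult.commute)
  then have \<mu>0: "A 0 = \<mu> * [:1, a:]"
    by (simp only: mult_cancel_left) simp
  have "\<mu> \<noteq> 0"
  proof
    assume "\<mu> = 0"
    then have "\<forall>j. ?ins u (\<psi> j) = 0"
      unfolding forall_2 using \<mu> \<mu>0 by (simp add: A_def)
    then show False using ker0[OF \<psi>] \<psi>0 by blast
  qed
  show ?thesis
  \<comment> \<open>Division by the content \<open>g\<close> lowers the degree bound of every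
    coordinate by \<open>degree g\<close>, and the degree of a form of degree \<open>d - 1\<close>
    along the curve by \<open>d - 1\<close> times as much.\<close>
  proof (rule that[of u c "M - degree g" l e \<psi> \<mu> a])
    show "f dvd P" if "homogeneous k P" "?ins u P = 0" for P k
      using ker[OF that(1) ker0[OF that]] .
    have "g ^ d * ?ins u f = 0"
      unfolding insU[OF f(1), symmetric] dehom_psubst[symmetric] \<phi>f by (simp add: dehom_def hom_simps)
    then show "?ins u f = 0" using g by simp
    show "degree (u i) \<le> M - degree g" for i
      using degU[of i] g by (cases "u i = 0") (auto simp: u degree_mult_eq)
    have eq: "dehom a h = g ^ (d - 1) * ?ins u (pdiff l f)"
      unfolding hU insU[OF pl] ..
    moreover have "dehom a h \<noteq> 0" using a by auto
    ultimately show nz: "?ins u (pdiff l f) \<noteq> 0" by auto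
    have "M * (d - 1) = (d - 1) * degree g + degree (?ins u (pdiff l f))"
      using deg_h g nz by (simp add: eq degree_mult_eq degree_power_eq)
    then show "degree (?ins u (pdiff l f)) = (M - degree g) * (d - 1)"
      by (simp add: diff_mult_distrib mult.commute)
  qed (use c \<psi> \<mu> \<mu>0 \<open>\<mu> \<noteq> 0\<close> in \<open>simp_all add: A_def mult.commute\<close>)
qed

section \<open>Cross products and polynomials in one variable\<close>

definition cross :: "(3 \<Rightarrow> 'a::comm_ring_1) \<Rightarrow> (3 \<Rightarrow> 'a) \<Rightarrow> 3 \<Rightarrow> 'a" where
  "cross a b i = (if i = 0 then a 1 * b 2 - a 2 * b 1
     else if i = 1 then a 2 * b 0 - a 0 * b 2 else a 0 * b 1 - a 1 * b 0)"

lemma cross_simps: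
  "cross a b 0 = a 1 * b 2 - a 2 * b 1" "cross a b 1 = a 2 * b 0 - a 0 * b 2"
  "cross a b 2 = a 0 * b 1 - a 1 * b 0"
  by (simp_all add: cross_def)

text \<open>Two vectors orthogonal to \<open>n\<close> in three-space have a cross product
  proportional to \<open>n\<close>; the vanishing minors express this without division.\<close>

lemma cross_parallel:
  fixes a b n :: "3 \<Rightarrow> 'a::idom"
  assumes "(\<Sum>i\<in>UNIV. a i * n i) = 0" "(\<Sum>i\<in>UNIV. b i * n i) = 0"
  shows "n i * cross a b j = n j * cross a b i"
proof -
  have "\<forall>i j. n i * cross a b j = n j * cross a b i"
    using assms unfolding forall_3 sum_3 cross_simps by - (intro conjI; (rule refl | algebra))
  then show ?thesis by blast
qed

lemma sum_mult_cross: "(\<Sum>i\<in>UNIV. a i * cross a b i) = 0"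
  by (simp add: sum_3 cross_def algebra_simps)

lemma cross_eq_0_iff: "(\<forall>i. cross a b i = 0) \<longleftrightarrow> (\<forall>i j. a i * b j = a j * b i)"
  by (auto simp: forall_3 cross_def mult.commute)

lemma homogeneous_cross_X:
  assumes "\<And>i. homogeneous k (a i)"
  shows "homogeneous (Suc k) (cross X a i)"
  unfolding cross_def using assms by (auto intro!: homogeneous_diff homogeneous_X_mult)

text \<open>The Bezout coefficients \<open>c\<close> produce the proportionality factor inside the
  ring.\<close>

lemma unimodular_parallel:
  fixes c n w :: "3 \<Rightarrow> 'a::comm_ring_1"
  assumes "(\<Sum>i\<in>UNIV. c i * n i) = 1" "\<And>i j. n i * w j = n j * w i"
  shows "w j = (\<Sum>i\<in>UNIV. c i * w i) * n j"
proof -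
  have "w j = (\<Sum>i\<in>UNIV. c i * n i) * w j"
    by (simp add: assms(1))
  also have "\<dots> = (\<Sum>i\<in>UNIV. c i * (n i * w j))"
    by (simp add: sum_distrib_right mult.assoc)
  also have "\<dots> = (\<Sum>i\<in>UNIV. c i * (n j * w i))"
    by (rule sum.cong[OF refl]) (simp only: assms(2)[of _ j])
  finally show ?thesis
    by (simp add: sum_distrib_left mult_ac)
qed

text \<open>The naive bound is \<open>2 * m - 1\<close>, but the contributions of the two top
  monomials cancel. The degree gained here is what makes the content of the gradient reach
  (d-1)(d-2).\<close>

lemma degree_wronskian_le:
  fixes p q :: "complex poly"
  assumes "degree p \<le> m" "degree q \<le> m" "1 \<le> m"
  shows "degree (p * pderiv q - q * pderiv p) \<le> 2 * m - 2"
proof -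
  define a b where "a = coeff p m" and "b = coeff q m"
  define p1 q1 where "p1 = p - monom a m" and "q1 = q - monom b m"
  have dp: "degree p1 \<le> m - 1" and dq: "degree q1 \<le> m - 1"
    using assms by (auto simp: p1_def q1_def a_def b_def intro!: degree_le)
      (metis One_nat_def Suc_pred coeff_eq_0 le_less_trans less_Suc_eq_le nat_neq_iff not_less_eq)+
  have dm: "pderiv (monom t m) = monom (of_nat m * t) (m - 1)" for t :: complex
    by (simp add: pderiv_monom)
  have deg_pd: "degree (monom t m * pderiv r) \<le> 2 * m - 2" if "degree r \<le> m - 1" for t :: complex and r
  proof (cases "degree r = 0")
    case True
    then have "pderiv r = 0" by (simp add: pderiv_eq_0_iff)
    then show ?thesis by simp
  next
    case False
    have "degree (monom t m * pderiv r) \<le> m + (degree r - 1)"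
      by (rule order_trans[OF degree_mult_le]) (auto simp: degree_pderiv intro!: add_mono degree_monom_le)
    then show ?thesis using that False by linarith
  qed
  have deg_pm: "degree (r * pderiv (monom t m)) \<le> 2 * m - 2" if "degree r \<le> m - 1" for t :: complex and r
  proof -
    have "degree (r * pderiv (monom t m)) \<le> (m - 1) + (m - 1)"
      unfolding dm by (rule order_trans[OF degree_mult_le]) (intro add_mono that degree_monom_le)
    then show ?thesis by linarith
  qed
  have deg_rr: "degree (r * pderiv s) \<le> 2 * m - 2" if "degree r \<le> m - 1" "degree s \<le> m - 1" for r s :: "complex poly"
  proof -
    have "degree (r * pderiv s) \<le> (m - 1) + (m - 1)"
      by (rule order_trans[OF degree_mult_le]) (use that in \<open>auto simp: degree_pderiv intro!: add_mono\<close>)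
    then show ?thesis by linarith
  qed
  have "monom a m * pderiv (monom b m) = monom b m * pderiv (monom a m)"
    by (simp add: dm mult_monom mult_ac)
  moreover have "p = monom a m + p1" "q = monom b m + q1"
    by (simp_all add: p1_def q1_def)
  ultimately have "p * pderiv q - q * pderiv p =
      (monom a m * pderiv q1 + p1 * pderiv (monom b m) + p1 * pderiv q1) -
      (monom b m * pderiv p1 + q1 * pderiv (monom a m) + q1 * pderiv p1)"
    by (simp add: pderiv_add algebra_simps)
  also have "degree \<dots> \<le> 2 * m - 2"
    using dp dq by (intro degree_diff_le degree_add_le deg_pd deg_pm deg_rr)
  finally show ?thesis .
qed

text \<open>Over the complex numbers divisibility can be compared root by root with multiplicity,
  which reduces a global statement to one node branch at a time.\<close>

lemma dvd_of_linear_powers_dvd: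
  fixes p q :: "complex poly"
  assumes "p \<noteq> 0" and dvd: "\<And>x n. [:- x, 1:] ^ n dvd p \<Longrightarrow> [:- x, 1:] ^ n dvd q"
  shows "p dvd q"
proof (cases "q = 0")
  case False
  have "proots p \<subseteq># proots q"
  proof (rule mset_subset_eqI)
    fix x
    show "count (proots p) x \<le> count (proots q) x"
      using assms(1) False dvd[OF order_1, of x] by (simp add: order_divides)
  qed
  then obtain A where A: "proots q = proots p + A"
    by (metis subset_mset.le_iff_add)
  have dec: "r = smult (lead_coeff r) (\<Prod>x\<in>#proots r. [:- x, 1:])" for r :: "complex poly"
    by (rule complex_poly_decompose_multiset[symmetric])
  have "q = smult (lead_coeff q / lead_coeff p) p * (\<Prod>x\<in>#A. [:- x, 1:])"
    using assms(1) by (subst dec[of q], subst (2) dec[of p]) (simp add: A)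
  then show ?thesis
    by (metis dvd_mult2 dvd_refl dvd_smult)
qed simp

text \<open>Counterpart of \<open>binary_powers_independent\<close>: subtracting the multiple of
  \<open>[:1, a:] ^ M\<close> that has the same value at 0 leaves a polynomial divisible by
  \<open>[:0, 1:]\<close>.\<close>

lemma degree_le_combination:
  fixes p :: "complex poly"
  assumes "degree p \<le> M"
  shows "\<exists>c. p = (\<Sum>i\<le>M. smult (c i) ([:1, a:] ^ i * [:0, 1:] ^ (M - i)))"
  using assms
proof (induction M arbitrary: p)
  case 0
  then obtain t where "p = [:t:]" by (metis degree_eq_zeroE le_zero_eq)
  then show ?case by (intro exI[of _ "\<lambda>_. t"]) (simp add: one_pCons)
next
  case (Suc M)
  define t where "t = poly p 0"
  have "poly (p - smult t ([:1, a:] ^ Suc M)) 0 = 0"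
    by (simp add: t_def)
  then obtain q where q: "p - smult t ([:1, a:] ^ Suc M) = [:0, 1:] * q"
    by (metis dvdE minus_zero poly_eq_0_iff_dvd)
  have "degree ([:1, a:] ^ Suc M) \<le> Suc M"
    by (rule order_trans[OF degree_power_le]) simp
  then have "degree (p - smult t ([:1, a:] ^ Suc M)) \<le> Suc M"
    using Suc.prems by (intro degree_diff_le) (auto intro: order_trans[OF degree_smult_le])
  then have "degree q \<le> M"
    unfolding q by (cases "q = 0") (auto simp: degree_mult_eq)
  then obtain c where c: "q = (\<Sum>i\<le>M. smult (c i) ([:1, a:] ^ i * [:0, 1:] ^ (M - i)))"
    using Suc.IH by blast
  let ?c = "\<lambda>i. if i \<le> M then c i else t"
  have "(\<Sum>i\<le>Suc M. smult (?c i) ([:1, a:] ^ i * [:0, 1:] ^ (Suc M - i))) =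
      (\<Sum>i\<le>M. smult (c i) ([:1, a:] ^ i * ([:0, 1:] * [:0, 1:] ^ (M - i)))) + smult t ([:1, a:] ^ Suc M)"
    by (auto simp: Suc_diff_le intro!: sum.cong)
  also have "\<dots> = [:0, 1:] * q + smult t ([:1, a:] ^ Suc M)"
    unfolding c sum_distrib_left by (simp only: mult_ac mult_smult_right)
  also have "\<dots> = p"
    unfolding q[symmetric] by simp
  finally show ?case by metis
qed

text \<open>A syzygy parallel to the position vector is contracted with the gradient; Euler's
  formula turns the relation into \<open>d\<close> times \<open>f\<close> times \<open>a i\<close>
  equal to 0.\<close>

lemma AR_homogeneous_eq_0:
  assumes f: "homogeneous d f" "f \<noteq> 0" "d \<noteq> 0" and a: "a \<in> AR f" and c: "\<And>i. cross X a i = 0"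
  shows "a i = 0"
proof -
  have "X j * a i = X i * a j" for j
    using cross_eq_0_iff[of X a] c by blast
  then have "(\<Sum>j\<in>UNIV. X j * a i * pdiff j f) = (\<Sum>j\<in>UNIV. X i * a j * pdiff j f)"
    by (intro sum.cong refl) (simp only:)
  also have "\<dots> = X i * (\<Sum>j\<in>UNIV. a j * pdiff j f)"
    by (simp add: sum_distrib_left mult_ac)
  also have "\<dots> = 0"
    using a by (simp add: AR_def)
  also have "(\<Sum>j\<in>UNIV. X j * a i * pdiff j f) = a i * (\<Sum>j\<in>UNIV. X j * pdiff j f)"
    by (simp add: sum_distrib_left mult_ac)
  finally show ?thesis
    using f by (simp add: euler[OF f(1)])
qed

lemma double_int_le: "a \<le> b + c \<Longrightarrow> 2 * int a \<le> 2 * int b + 2 * int c"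
  by simp

text \<open>Doubling clears the denominator, so that the dimension counts become polynomial
  inequalities over the integers.\<close>

lemma double_choose_2: "2 * int ((n + 2) choose 2) = (int n + 2) * (int n + 1)"
proof -
  have "2 * ((n + 2) choose 2) = (n + 2) * (n + 1)"
    by (simp add: choose_two)
  from arg_cong[OF this, of int] show ?thesis
    by (simp add: algebra_simps)
qed

text \<open>The output of \<open>rational_curve_parametrization\<close>. The degree \<open>m\<close>
  is kept apart from \<open>d\<close> until \<open>m_eq_d\<close>, and \<open>l\<close> is an index
  for which the partial derivative attains the full degree.\<close>

locale rational_nodal_curve =
  fixes f :: "3 cpoly" and d m e :: nat and u c :: "3 \<Rightarrow> complex poly"
    and \<psi> :: "2 \<Rightarrow> 3 cpoly" and \<mu> :: "complex poly" and a0 :: complex and l :: 3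
  assumes f: "homogeneous d f" "f \<noteq> 0" and d: "2 \<le> d" and nodal: "nodal f"
    and kernel: "\<And>P k. homogeneous k P \<Longrightarrow> insertion (\<lambda>c. [:c:]) u P = 0 \<Longrightarrow> f dvd P"
    and on_curve: "insertion (\<lambda>c. [:c:]) u f = 0"
    and unimodular: "(\<Sum>i\<in>UNIV. c i * u i) = 1"
    and degree_u: "\<And>i. degree (u i) \<le> m"
    and pdiff_l: "insertion (\<lambda>c. [:c:]) u (pdiff l f) \<noteq> 0"
      "degree (insertion (\<lambda>c. [:c:]) u (pdiff l f)) = m * (d - 1)"
    and \<psi>: "\<And>j. homogeneous e (\<psi> j)"
    and inverse: "insertion (\<lambda>c. [:c:]) u (\<psi> 0) = \<mu> * [:1, a0:]"
      "insertion (\<lambda>c. [:c:]) u (\<psi> 1) = \<mu> * [:0, 1:]" "\<mu> \<noteq> 0"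
begin

section \<open>Hilbert function of the curve and degree of the parametrization\<close>

definition ev :: "3 cpoly \<Rightarrow> complex poly" where
  "ev = insertion (\<lambda>c. [:c:]) u"

lemma ev_simps [simp]:
  "ev 0 = 0" "ev 1 = 1" "ev (P + Q) = ev P + ev Q" "ev (P - Q) = ev P - ev Q" "ev (- P) = - ev P"
  "ev (P * Q) = ev P * ev Q" "ev (P ^ n) = ev P ^ n" "ev (cst t) = [:t:]" "ev (X i) = u i"
  "ev (sum h A) = (\<Sum>x\<in>A. ev (h x))"
  unfolding ev_def by (simp_all add: insertion_simps[OF const_poly_hom] insertion_cst[OF const_poly_hom]
      insertion_X[OF const_poly_hom])

lemma ev_cross: "ev (cross v w i) = cross (\<lambda>i. ev (v i)) (\<lambda>i. ev (w i)) i"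
  by (simp add: cross_def)

lemma ev_f [simp]: "ev f = 0"
  using on_curve by (simp add: ev_def)

lemma degree_ev: "homogeneous k P \<Longrightarrow> degree (ev P) \<le> m * k"
  unfolding ev_def by (rule degree_insertion_le[OF degree_u])

lemma ev_eq_0E:
  assumes "homogeneous (k + d) P" "ev P = 0"
  obtains Q where "homogeneous k Q" "P = f * Q"
proof (cases "P = 0")
  case True
  then show ?thesis using that[of 0] by simp
next
  case False
  have "f dvd P" using kernel assms by (simp add: ev_def)
  then show ?thesis
    by (rule homogeneous_dvdE[OF f(1) assms(1) _ False]) (use that in simp)
qed

lemma ev_eq_0_low_degree:
  assumes "homogeneous k P" "ev P = 0" "k < d"
  shows "P = 0"
proof (rule ccontr)
  assume "P \<noteq> 0"
  have "f dvd P" using kernel assms by (simp add: ev_def)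
  then show False
    by (rule homogeneous_dvdE[OF f(1) assms(1) _ \<open>P \<noteq> 0\<close>]) (use assms(3) in simp)
qed

lemma linear_ev: "Vector_Spaces.linear (\<lambda>c (p :: 3 cpoly). cst c * p) smult ev"
  by unfold_locales simp_all

lemma linear_times_f: "Vector_Spaces.linear (\<lambda>c (p :: 3 cpoly). cst c * p) (\<lambda>c (p :: 3 cpoly). cst c * p) (\<lambda>p. f * p)"
  by unfold_locales (simp_all add: algebra_simps)

lemma dim_ideal: "cpoly.dim ((\<lambda>p. f * p) ` forms k) = (k + 2) choose 2"
  and fin_dim_ideal: "cpoly.fin_dim ((\<lambda>p. f * p) ` forms k)"
proof -
  interpret L: Vector_Spaces.linear "\<lambda>c (p :: 3 cpoly). cst c * p" "\<lambda>c (p :: 3 cpoly). cst c * p" "\<lambda>p. f * p"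
    by (rule linear_times_f)
  have "{x \<in> forms k. f * x = 0} = {0}" using f by auto
  moreover have "cpoly.dim {0 :: 3 cpoly} = 0"
    using cpoly.dim_le_card[of "{0 :: 3 cpoly}" "{}"] by simp
  ultimately show "cpoly.dim ((\<lambda>p. f * p) ` forms k) = (k + 2) choose 2"
    using L.dim_kernel_image[OF subspace_forms fin_dim_forms] by (simp add: dim_forms)
  show "cpoly.fin_dim ((\<lambda>p. f * p) ` forms k)"
    by (rule L.fin_dim_image[OF fin_dim_forms])
qed

text \<open>Rank-nullity, where the kernel of \<open>ev\<close> consists of the multiples of
  \<open>f\<close>. The dimension of the image thus grows with slope \<open>d\<close>, independently
  of \<open>m\<close>.\<close>

lemma dim_ev_forms: "((k + d + 2) choose 2) = ((k + 2) choose 2) + upoly.dim (ev ` forms (k + d))"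
proof -
  interpret L: Vector_Spaces.linear "\<lambda>c (p :: 3 cpoly). cst c * p" smult ev by (rule linear_ev)
  have "{P \<in> forms (k + d). ev P = 0} = (\<lambda>p. f * p) ` forms k"
  proof (intro equalityI subsetI)
    fix P assume "P \<in> {P \<in> forms (k + d). ev P = 0}"
    then obtain Q where "homogeneous k Q" "P = f * Q"
      using ev_eq_0E by blast
    then show "P \<in> (\<lambda>p. f * p) ` forms k" by blast
  next
    fix P assume "P \<in> (\<lambda>p. f * p) ` forms k"
    then obtain Q where "homogeneous k Q" "P = f * Q" by blast
    then show "P \<in> {P \<in> forms (k + d). ev P = 0}"
      using homogeneous_mult[OF f(1), of k Q] by (simp add: add.commute)
  qed
  then show ?thesis
    using L.dim_kernel_image[OF subspace_forms fin_dim_forms, of "k + d"] by (simp add: dim_forms dim_ideal)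
qed

text \<open>The image of \<open>ev\<close> lies among polynomials whose degree bound grows with
  slope \<open>m\<close>, while its dimension grows with slope \<open>d\<close>.\<close>

lemma d_le_m: "d \<le> m"
proof (rule ccontr)
  assume "\<not> d \<le> m"
  \<comment> \<open>Large enough that \<open>2 * n\<close> exceeds the constant
    \<open>2 * m * d + 2\<close> of the comparison.\<close>
  define n where "n = m * d + 2"
  have "upoly.dim (ev ` forms (n + d)) \<le> upoly.dim {p. degree p \<le> m * (n + d)}"
    using degree_ev by (intro upoly.dim_mono fin_dim_degree_le) auto
  then have "((n + d + 2) choose 2) \<le> ((n + 2) choose 2) + (m * (n + d) + 1)"
    using dim_ev_forms[of n] by (simp add: dim_degree_le)
  then have "2 * int ((n + d + 2) choose 2) \<le> 2 * int ((n + 2) choose 2) + 2 * int (m * (n + d) + 1)"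
    by (rule double_int_le)
  then have "2 * int n * (int d - int m) \<le> 2 * int m * int d + 2 - int d * int d - 3 * int d"
    unfolding double_choose_2 by (simp add: algebra_simps)
  moreover have "2 * int n * 1 \<le> 2 * int n * (int d - int m)"
    using \<open>\<not> d \<le> m\<close> by (intro mult_left_mono) auto
  moreover have "int n = int m * int d + 2" by (simp add: n_def)
  moreover have "0 \<le> int d * int d" "0 \<le> int m * int d" by simp_all
  ultimately show False by linarith
qed

text \<open>If all coordinates had smaller degree, the partial derivative with index
  \<open>l\<close> could not reach degree \<open>m * (d - 1)\<close>.\<close>

lemma degree_u_max: "\<exists>i. degree (u i) = m"
proof (rule ccontr)
  assume "\<nexists>i. degree (u i) = m"
  then have "degree (u i) \<le> m - 1" for i
    using degree_u[of i] by (metis Suc_pred' diff_is_0_eq' le_antisym less_Suc_eq_le nat_less_le not_gr_zero)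
  from degree_insertion_le[of u "m - 1", OF this homogeneous_pdiff[OF f(1), of l]]
  have "m * (d - 1) \<le> (m - 1) * (d - 1)"
    using pdiff_l(2) by simp
  moreover have "(m - 1) * (d - 1) < m * (d - 1)"
    using d_le_m d by simp
  ultimately show False by simp
qed

text \<open>Multiplying the Bezout relation by \<open>p\<close> gives a decomposition without degree
  control. All coefficients except that of a coordinate \<open>u i0\<close> of full degree are
  reduced modulo \<open>u i0\<close>, the quotients are absorbed at \<open>i0\<close>, and the
  degree there is then forced by that of \<open>p\<close>.\<close>

lemma degree_le_decomp:
  assumes "degree p \<le> m * (n + 2)"
  obtains b where "p = (\<Sum>i\<in>UNIV. u i * b i)" "\<And>i. degree (b i) \<le> m * (n + 1)"
proof -
  obtain i0 where i0: "degree (u i0) = m" using degree_u_max by blast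
  have m: "2 \<le> m" using d_le_m d by simp
  then have u0: "u i0 \<noteq> 0" using i0 by auto
  define b where "b = (\<lambda>i. if i = i0 then p * c i0 + (\<Sum>j\<in>UNIV - {i0}. u j * ((p * c j) div u i0))
     else (p * c i) mod u i0)"
  have bi: "degree (b i) < m" if "i \<noteq> i0" for i
    using degree_mod_less'[OF u0, of "p * c i"] that m i0 unfolding b_def
    by (cases "(p * c i) mod u i0 = 0") auto
  have "(\<Sum>i\<in>UNIV. u i * b i) = u i0 * b i0 + (\<Sum>i\<in>UNIV - {i0}. u i * b i)"
    by (simp add: sum.remove[of UNIV i0])
  also have "u i0 * b i0 = u i0 * (p * c i0) + (\<Sum>i\<in>UNIV - {i0}. u i * (u i0 * ((p * c i) div u i0)))"
    by (simp add: b_def distrib_left sum_distrib_left mult_ac)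
  also have "\<dots> + (\<Sum>i\<in>UNIV - {i0}. u i * b i) =
      u i0 * (p * c i0) + (\<Sum>i\<in>UNIV - {i0}. u i * (u i0 * ((p * c i) div u i0)) + u i * b i)"
    by (simp add: sum.distrib add.assoc)
  also have "(\<Sum>i\<in>UNIV - {i0}. u i * (u i0 * ((p * c i) div u i0)) + u i * b i) = (\<Sum>i\<in>UNIV - {i0}. u i * (p * c i))"
    by (rule sum.cong) (simp_all add: b_def flip: distrib_left)
  also have "u i0 * (p * c i0) + \<dots> = (\<Sum>i\<in>UNIV. u i * (p * c i))"
    by (simp add: sum.remove[of UNIV i0])
  also have "\<dots> = p * (\<Sum>i\<in>UNIV. c i * u i)"
    by (simp add: sum_distrib_left mult_ac)
  finally have p: "p = (\<Sum>i\<in>UNIV. u i * b i)"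
    by (simp add: unimodular)
  have "degree (b i) \<le> m * (n + 1)" for i
  proof (cases "i = i0")
    case True
    have "u i0 * b i0 = p - (\<Sum>i\<in>UNIV - {i0}. u i * b i)"
      using p by (simp add: sum.remove[of UNIV i0])
    moreover have "degree (\<Sum>i\<in>UNIV - {i0}. u i * b i) \<le> m + m"
      by (intro degree_sum_le order_trans[OF degree_mult_le] add_mono degree_u) (use bi in \<open>auto intro: less_imp_le\<close>)
    \<comment> \<open>The reason for \<open>n + 2\<close>: the remainder terms have degree up to
      \<open>2 * m\<close>.\<close>
    moreover have "m + m \<le> m * (n + 2)" by simp
    ultimately have "degree (u i0 * b i0) \<le> m * (n + 2)"
      using assms by (simp add: degree_diff_le)
    then show ?thesis
      using True u0 i0 by (cases "b i0 = 0") (auto simp: degree_mult_eq)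
  next
    case False
    have "m \<le> m * (n + 1)" by simp
    then show ?thesis using bi[OF False] by linarith
  qed
  with p show ?thesis using that by blast
qed

text \<open>
  The subring of the \<open>ev P\<close> contains a conductor: \<open>\<mu> ^ m\<close> moves all polynomials of the
  right degree into it, because \<open>\<psi>\<close> recovers the parameter up to the factor \<open>\<mu>\<close>.
  Comparing dimensions, the parametrization has degree \<open>d\<close>.
\<close>

lemma conductor:
  assumes "degree p \<le> m * (n + 1)"
  shows "\<exists>P. homogeneous (n + e * m) P \<and> ev P = \<mu> ^ m * p"
  using assms
proof (induction n arbitrary: p)
  case 0
  then obtain t where t: "p = (\<Sum>i\<le>m. smult (t i) ([:1, a0:] ^ i * [:0, 1:] ^ (m - i)))"
    using degree_le_combination[of p m a0] by auto
  \<comment> \<open>The polynomial \<open>p\<close> is read as a binary form of degree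
    \<open>m\<close> and evaluated at \<psi>; each of the \<open>m\<close> factors contributes
    degree \<open>e\<close> and one \<mu>.\<close>
  let ?P = "\<Sum>i\<le>m. cst (t i) * (\<psi> 0 ^ i * \<psi> 1 ^ (m - i))"
  have "homogeneous (e * m) (\<psi> 0 ^ i * \<psi> 1 ^ (m - i))" if "i \<le> m" for i
    using homogeneous_mult[OF homogeneous_power[OF \<psi>[of 0], of i] homogeneous_power[OF \<psi>[of 1], of "m - i"]] that
    by (simp flip: distrib_left)
  then have "homogeneous (0 + e * m) ?P"
    by (auto intro!: homogeneous_sum homogeneous_scale)
  moreover have "ev ?P = \<mu> ^ m * p"
  proof -
    have "ev (cst (t i) * (\<psi> 0 ^ i * \<psi> 1 ^ (m - i))) = \<mu> ^ m * smult (t i) ([:1, a0:] ^ i * [:0, 1:] ^ (m - i))"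
      if "i \<le> m" for i
    proof -
      have "\<mu> ^ m = \<mu> ^ i * \<mu> ^ (m - i)" using that by (simp flip: power_add)
      then have *: "[:t i:] * ((\<mu> * A) ^ i * (\<mu> * B) ^ (m - i)) = \<mu> ^ m * smult (t i) (A ^ i * B ^ (m - i))" for A B
        by (simp add: power_mult_distrib mult_ac)
      show ?thesis
        unfolding *[symmetric] by (simp only: ev_simps inverse[folded ev_def])
    qed
    then show ?thesis
      unfolding t sum_distrib_left ev_simps(10) by (intro sum.cong) auto
  qed
  ultimately show ?case by blast
next
  case (Suc n)
  then have "degree p \<le> m * (n + 2)" by simp
  then obtain b where b: "p = (\<Sum>i\<in>UNIV. u i * b i)" "\<And>i. degree (b i) \<le> m * (n + 1)"
    using degree_le_decomp by blast
  have "\<forall>i. \<exists>P. homogeneous (n + e * m) P \<and> ev P = \<mu> ^ m * b i"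
    using Suc.IH b(2) by blast
  then obtain P where P: "\<And>i. homogeneous (n + e * m) (P i)" "\<And>i. ev (P i) = \<mu> ^ m * b i"
    by metis
  \<comment> \<open>Multiplication by the variables realizes the factors \<open>u i\<close> and
    raises the degree of the form by one.\<close>
  have "homogeneous (Suc (n + e * m)) (\<Sum>i\<in>UNIV. X i * P i)"
    by (intro homogeneous_sum homogeneous_X_mult P)
  moreover have "ev (\<Sum>i\<in>UNIV. X i * P i) = \<mu> ^ m * p"
    by (simp add: P b(1) sum_distrib_left mult_ac)
  ultimately show ?case by auto
qed

text \<open>By \<open>conductor\<close> the image of \<open>ev\<close> contains a copy of the
  polynomials of degree at most \<open>m * (N + 1)\<close>, but its dimension grows only with slope
  \<open>d\<close>.\<close>

lemma m_eq_d: "m = d"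
proof (rule antisym)
  show "m \<le> d"
  proof (rule ccontr)
    assume "\<not> m \<le> d"
    \<comment> \<open>Large enough that \<open>2 * n\<close> exceeds \<open>2 * d * e * m\<close>,
      the cost of the degree shift by the conductor.\<close>
    define n where "n = e * m * d + d * d + 3 * d"
    define N where "N = d + n"
    interpret L: Vector_Spaces.linear smult smult "\<lambda>p :: complex poly. \<mu> ^ m * p"
      by unfold_locales (simp_all add: algebra_simps)
    have "(\<lambda>p. \<mu> ^ m * p) ` {p. degree p \<le> m * (N + 1)} \<subseteq> ev ` forms (N + e * m)"
      using conductor[of _ N] by (auto simp: image_iff) (metis mult.commute)
    moreover have "upoly.fin_dim (ev ` forms k)" for k
      using degree_ev by (intro upoly.fin_dim_subset[OF _ fin_dim_degree_le[of "m * k"]]) auto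
    ultimately have "m * (N + 1) + 1 \<le> upoly.dim (ev ` forms (N + e * m))"
      unfolding dim_degree_le[symmetric] using inverse(3)
      by (intro L.dim_le_of_inj subspace_degree_le fin_dim_degree_le) auto
    moreover have "N + e * m = (n + e * m) + d" by (simp add: N_def)
    ultimately have "((n + e * m + 2) choose 2) + (m * (N + 1) + 1) \<le> ((n + e * m + d + 2) choose 2)"
      using dim_ev_forms[of "n + e * m"] by simp
    then have "int ((n + e * m + 2) choose 2) + int (m * (N + 1) + 1) \<le> int ((n + e * m + d + 2) choose 2)"
      by (metis of_nat_add of_nat_mono)
    from mult_left_mono[OF this, of 2]
    have "2 * int ((n + e * m + 2) choose 2) + 2 * int (m * (N + 1) + 1) \<le> 2 * int ((n + e * m + d + 2) choose 2)"
      unfolding distrib_left by simp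
    then have *: "2 * (int m * (int N + 1)) + 2 \<le> 2 * int d * (int n + int (e * m)) + int d * int d + 3 * int d"
      unfolding double_choose_2 by (simp add: algebra_simps)
    have "(int d + 1) * (int N + 1) \<le> int m * (int N + 1)"
      using \<open>\<not> m \<le> d\<close> by (intro mult_right_mono) auto
    with * have "2 * ((int d + 1) * (int N + 1)) + 2 \<le> 2 * int d * (int n + int (e * m)) + int d * int d + 3 * int d"
      by linarith
    moreover have "int N = int d + int n" by (simp add: N_def)
    ultimately have "2 * ((int d + 1) * (int d + int n + 1)) + 2 \<le> 2 * int d * (int n + int (e * m)) + int d * int d + 3 * int d"
      by simp
    then have "int d * int d + 4 + int d + 2 * int n \<le> 2 * (int d * int (e * m))"
      by (simp add: algebra_simps)
    moreover have "int n = int d * int (e * m) + int d * int d + 3 * int d"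
      by (simp add: n_def algebra_simps)
    moreover have "0 \<le> int d * int d" by simp
    ultimately show False by linarith
  qed
qed (rule d_le_m)

end

context rational_nodal_curve
begin

section \<open>The gradient along the curve and syzygies of low degree\<close>

definition G :: "3 \<Rightarrow> complex poly" where
  "G i = ev (pdiff i f)"

lemma G_l: "G l \<noteq> 0" "degree (G l) = d * (d - 1)"
  using pdiff_l by (simp_all add: G_def ev_def m_eq_d)

lemma sum_u_G: "(\<Sum>i\<in>UNIV. u i * G i) = 0"
  using arg_cong[OF euler[OF f(1)], of ev] by (simp add: G_def)

lemma sum_pderiv_u_G: "(\<Sum>i\<in>UNIV. pderiv (u i) * G i) = 0"
  using pderiv_insertion[of u f] on_curve by (simp add: G_def ev_def)

text \<open>\<open>W\<close> and the gradient are both orthogonal to \<open>u\<close> and its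
  derivative, so \<open>W\<close> is a multiple of the primitive part \<open>N\<close>. The degree
  of \<open>N\<close> is then at most \<open>2 * d - 2\<close>, and the rest of the degree
  \<open>d * (d - 1)\<close> belongs to the content \<Delta>.\<close>

lemma gradient_factor:
  obtains \<Delta> N b where "\<Delta> \<noteq> 0" "\<And>i. G i = \<Delta> * N i" "(\<Sum>i\<in>UNIV. b i * N i) = 1"
    "(d - 1) * (d - 2) \<le> degree \<Delta>" "degree \<Delta> \<le> d * (d - 1)"
proof -
  obtain \<Delta> N b where \<Delta>: "\<Delta> \<noteq> 0" and N: "\<And>i. G i = \<Delta> * N i" and b: "(\<Sum>i\<in>UNIV. b i * N i) = 1"
    using unimodular_factor[of G] G_l(1) by metis
  define W where "W = cross u (\<lambda>i. pderiv (u i))"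
  have "G i * W j = G j * W i" for i j
    unfolding W_def by (rule cross_parallel[OF sum_u_G sum_pderiv_u_G])
  then have "\<Delta> * (N i * W j) = \<Delta> * (N j * W i)" for i j
    unfolding N by (simp only: mult.assoc)
  then have "N i * W j = N j * W i" for i j
    using \<Delta> by simp
  from unimodular_parallel[OF b this] obtain \<kappa> where \<kappa>: "\<And>j. W j = \<kappa> * N j"
    by blast
  \<comment> \<open>If \<open>W\<close> vanished, the derivative of \<open>u\<close> would be a
    polynomial multiple of \<open>u\<close>, which the degrees exclude.\<close>
  have "\<kappa> \<noteq> 0"
  proof
    assume "\<kappa> = 0"
    then have "\<And>i. W i = 0" using \<kappa> by simp
    then have "u i * pderiv (u j) = u j * pderiv (u i)" for i j
      unfolding W_def using cross_eq_0_iff[of u "\<lambda>i. pderiv (u i)"] by blast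
    from unimodular_parallel[OF unimodular this] obtain t where t: "\<And>j. pderiv (u j) = t * u j"
      by blast
    obtain i where i: "degree (u i) = d" using degree_u_max m_eq_d by blast
    then have nz: "pderiv (u i) \<noteq> 0"
      using d by (simp add: pderiv_eq_0_iff)
    then have "t \<noteq> 0" "u i \<noteq> 0" unfolding t[of i] by auto
    then have "degree (pderiv (u i)) = degree t + d"
      unfolding t[of i] by (simp add: degree_mult_eq i)
    then show False using d by (simp add: degree_pderiv i)
  qed
  have "N l \<noteq> 0" using G_l(1) N by auto
  then have "degree (N l) \<le> degree (W l)"
    using \<open>\<kappa> \<noteq> 0\<close> by (simp add: \<kappa> degree_mult_eq)
  also have "\<dots> \<le> 2 * d - 2"
    unfolding W_def cross_def using degree_wronskian_le[of _ d] degree_u m_eq_d d by simp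
  finally have "degree (N l) \<le> 2 * d - 2" .
  moreover have deg: "d * (d - 1) = degree \<Delta> + degree (N l)"
    using G_l \<Delta> \<open>N l \<noteq> 0\<close> by (simp add: N degree_mult_eq)
  moreover have "(d - 1) * (d - 2) + (2 * d - 2) = d * (d - 1)"
  proof -
    obtain n where "d = n + 2" using d le_Suc_ex by (metis add.commute)
    then show ?thesis by (simp add: algebra_simps)
  qed
  ultimately have "(d - 1) * (d - 2) \<le> degree \<Delta>" by linarith
  then show ?thesis
    by (rule that[OF \<Delta> N b]) (use deg in linarith)
qed

text \<open>Unimodularity makes the image of \<open>x\<close> a genuine projective point, so
  nodality applies to it.\<close>

lemma singular_parameter:
  assumes "\<And>i. poly (G i) x = 0"
  shows "node f (\<lambda>i. poly (u i) x)" and "eval (\<lambda>i. poly (u i) x) (pdiff i f) = 0"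
proof -
  let ?p = "\<lambda>i. poly (u i) x"
  have *: "eval ?p P = poly (ev P) x" for P
    by (simp add: ev_def poly_insertion)
  show g: "eval ?p (pdiff i f) = 0" for i
    using assms by (simp add: * G_def)
  have "\<exists>i. ?p i \<noteq> 0"
  proof (rule ccontr)
    assume "\<nexists>i. ?p i \<noteq> 0"
    then have "poly (\<Sum>i\<in>UNIV. c i * u i) x = 0" by (simp add: poly_sum)
    then show False unfolding unimodular by simp
  qed
  then have "singular_point f ?p"
    using g by (auto simp: singular_point_def *[of f])
  then show "node f ?p" using nodal by (simp add: nodal_def)
qed

text \<open>Orthogonality gives a multiple \<open>w\<close> of the primitive gradient
  \<open>N\<close>; the nodes are needed to split off the whole content \<Delta> from
  \<open>w\<close>. The degree bound is written additively to avoid truncated subtraction.\<close>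

lemma syzygy_multiple_of_gradient:
  assumes a: "a \<in> AR f" "\<And>i. homogeneous k (a i)"
  obtains \<rho> where "\<And>i. ev (cross X a i) = \<rho> * G i" "\<rho> = 0 \<or> degree \<rho> + d * (d - 1) \<le> d * (k + 1)"
proof -
  obtain \<Delta> N b where \<Delta>: "\<Delta> \<noteq> 0" and N: "\<And>i. G i = \<Delta> * N i" and b: "(\<Sum>i\<in>UNIV. b i * N i) = 1"
    using gradient_factor by metis
  define H where "H = (\<lambda>i. ev (cross X a i))"
  have H: "H = cross u (\<lambda>i. ev (a i))"
    by (simp add: H_def ev_cross fun_eq_iff)
  have "(\<Sum>i\<in>UNIV. a i * pdiff i f) = 0" using a(1) by (simp add: AR_def)
  from arg_cong[OF this, of ev] have "(\<Sum>i\<in>UNIV. ev (a i) * G i) = 0"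
    by (simp add: G_def)
  from cross_parallel[OF sum_u_G this] have "G i * H j = G j * H i" for i j
    unfolding H .
  then have "\<Delta> * (N i * H j) = \<Delta> * (N j * H i)" for i j
    unfolding N by (simp only: mult.assoc)
  then have "N i * H j = N j * H i" for i j
    using \<Delta> by simp
  from unimodular_parallel[OF b this] obtain w where w: "\<And>j. H j = w * N j"
    by blast
  \<comment> \<open>Checked at each root of \<Delta>: \<open>power_dvd_at_node\<close> gives the
    divisibility for every component of \<open>H\<close>, and the Bezout relation for
    \<open>N\<close> passes it on to \<open>w\<close>.\<close>
  have "\<Delta> dvd w"
  proof (rule dvd_of_linear_powers_dvd[OF \<Delta>])
    fix x n assume n: "[:- x, 1:] ^ n dvd \<Delta>"
    let ?p = "\<lambda>i. poly (u i) x"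
    show "[:- x, 1:] ^ n dvd w"
    proof (cases "n = 0")
      case False
      then have "[:- x, 1:] dvd \<Delta>"
        using n by (meson dvd_power dvd_trans neq0_conv)
      then have "poly (G i) x = 0" for i
        by (simp add: N poly_eq_0_iff_dvd)
      from singular_parameter[OF this] have node: "node f ?p" and sing: "\<And>i. eval ?p (pdiff i f) = 0"
        by blast+
      have "[:- x, 1:] ^ n dvd H i" for i
        unfolding H_def ev_def
      proof (rule power_dvd_at_node[OF node f(1) d sing])
        show "P = 0" if "homogeneous 1 P" "insertion (\<lambda>c. [:c:]) u P = 0" for P
          using ev_eq_0_low_degree[OF that(1)] that(2) d by (simp add: ev_def)
        show "[:- x, 1:] ^ n dvd insertion (\<lambda>c. [:c:]) u (pdiff l f)" for l
          using n N[of l] by (simp add: G_def ev_def)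
        show "homogeneous (Suc k) (cross X a i)"
          by (rule homogeneous_cross_X[OF a(2)])
        \<comment> \<open>At the node the syzygy is parallel to the position vector, so the form
          \<open>cross X a i\<close> vanishes there.\<close>
        have "\<And>i j. ?p i * eval ?p (a j) = ?p j * eval ?p (a i)"
          by (rule AR_at_node[OF node f(1) sing a(1)])
        then have "cross ?p (\<lambda>i. eval ?p (a i)) i = 0"
          using cross_eq_0_iff by blast
        then show "eval ?p (cross X a i) = 0"
          by (auto simp: cross_def eval_eq_insertion insertion_simps[OF id_hom] insertion_X[OF id_hom] split: if_splits)
      qed
      then have "[:- x, 1:] ^ n dvd (\<Sum>i\<in>UNIV. b i * H i)"
        by (intro dvd_sum dvd_mult)
      also have "(\<Sum>i\<in>UNIV. b i * H i) = w * (\<Sum>i\<in>UNIV. b i * N i)"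
        by (simp add: w sum_distrib_left mult_ac)
      finally show ?thesis by (simp add: b)
    qed simp
  qed
  then obtain \<rho> where \<rho>: "w = \<Delta> * \<rho>" ..
  have HG: "H i = \<rho> * G i" for i
    by (simp add: w \<rho> N mult_ac)
  moreover have "\<rho> = 0 \<or> degree \<rho> + d * (d - 1) \<le> d * (k + 1)"
  proof (cases "\<rho> = 0")
    case False
    have "degree (H l) \<le> m * Suc k"
      unfolding H_def by (rule degree_ev[OF homogeneous_cross_X[OF a(2)]])
    then show ?thesis
      using False G_l by (simp add: HG degree_mult_eq m_eq_d)
  qed simp
  ultimately show ?thesis using that H_def by blast
qed

text \<open>The degree bound leaves \<rho> equal to 0, or a constant \<open>t\<close> with
  \<open>k = d - 2\<close>. In the second case the cross product is \<open>t\<close> times the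
  gradient, and contraction with the position vector gives \<open>t * d * f = 0\<close>.\<close>

lemma AR_low_degree:
  assumes a: "a \<in> AR f" "\<And>i. homogeneous k (a i)" and k: "k < d - 1"
  shows "a i = 0"
proof -
  obtain \<rho> where \<rho>: "\<And>i. ev (cross X a i) = \<rho> * G i" "\<rho> = 0 \<or> degree \<rho> + d * (d - 1) \<le> d * (k + 1)"
    using syzygy_multiple_of_gradient[OF a] by blast
  have hc: "homogeneous (Suc k) (cross X a i)" for i
    by (rule homogeneous_cross_X[OF a(2)])
  have "\<rho> = 0"
  proof (rule ccontr)
    assume "\<rho> \<noteq> 0"
    have "d * (k + 1) \<le> d * (d - 1)" using k by (intro mult_left_mono) auto
    with \<rho>(2) \<open>\<rho> \<noteq> 0\<close> have "degree \<rho> = 0" and eq: "d * (d - 1) = d * (k + 1)" by linarith+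
    then obtain t where t: "\<rho> = [:t:]" by (metis degree_eq_zeroE)
    have "d - 1 = k + 1"
      by (rule iffD1[OF nat_mult_eq_cancel1 eq]) (use d in simp)
    then have k1: "Suc k = d - 1" by simp
    \<comment> \<open>Both sides have degree \<open>d - 1\<close>, below \<open>d\<close>, so
      equality along the curve is equality of forms.\<close>
    have "cross X a i = cst t * pdiff i f" for i
    proof -
      have "homogeneous (Suc k) (cross X a i - cst t * pdiff i f)"
        using hc homogeneous_pdiff[OF f(1)] k1 by (auto intro!: homogeneous_diff homogeneous_scale)
      moreover have "ev (cross X a i - cst t * pdiff i f) = 0"
        using \<rho>(1)[of i] by (simp add: t G_def)
      ultimately have "cross X a i - cst t * pdiff i f = 0"
        using k by (intro ev_eq_0_low_degree) auto
      then show ?thesis by simp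
    qed
    then have "cst t * (\<Sum>i\<in>UNIV. X i * pdiff i f) = (\<Sum>i\<in>UNIV. X i * cross X a i)"
      by (simp add: sum_distrib_left mult_ac)
    then have "cst t * (of_nat d * f) = 0"
      by (simp add: euler[OF f(1)] sum_mult_cross)
    then show False using f(2) d t \<open>\<rho> \<noteq> 0\<close> by simp
  qed
  then have "cross X a i = 0" for i
    using \<rho>(1)[of i] k by (intro ev_eq_0_low_degree[OF hc]) auto
  moreover have "d \<noteq> 0" using d by simp
  ultimately show ?thesis
    by (intro AR_homogeneous_eq_0[OF f _ a(1)])
qed

lemma mdr_eq: "mdr f = d - 1"
  unfolding mdr_def
proof (rule Least_equality)
  have "pdiff l f \<noteq> 0" using G_l by (auto simp: G_def)
  obtain j where j: "j \<noteq> l" by (metis (full_types) zero_neq_one)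
  \<comment> \<open>The Koszul syzygy between two partial derivatives; it is non-zero because the
    partial with index \<open>l\<close> is.\<close>
  define a where "a = (\<lambda>i. 0)(l := pdiff j f, j := - pdiff l f)"
  have "(\<Sum>i\<in>UNIV. a i * pdiff i f) =
      (\<Sum>i\<in>UNIV. (if i = l then pdiff j f * pdiff l f else 0) - (if i = j then pdiff l f * pdiff j f else 0))"
    by (rule sum.cong) (use j in \<open>auto simp: a_def\<close>)
  then have a: "a \<in> AR f"
    by (simp add: AR_def sum_subtractf sum.delta mult.commute)
  have "\<forall>i. homogeneous (d - 1) (a i)"
    using homogeneous_pdiff[OF f(1)] by (auto simp: a_def intro: homogeneous_uminus)
  moreover have "\<exists>i. a i \<noteq> 0"
    using \<open>pdiff l f \<noteq> 0\<close> by (intro exI[of _ j]) (simp add: a_def)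
  ultimately show "\<exists>a\<in>AR f. (\<forall>i. homogeneous (d - 1) (a i)) \<and> (\<exists>i. a i \<noteq> 0)"
    using a by (intro bexI conjI)
next
  fix k assume "\<exists>a\<in>AR f. (\<forall>i. homogeneous k (a i)) \<and> (\<exists>i. a i \<noteq> 0)"
  then obtain a where a: "a \<in> AR f" "\<forall>i. homogeneous k (a i)" "\<exists>i. a i \<noteq> 0" by (elim bexE conjE)
  show "d - 1 \<le> k"
  proof (rule ccontr)
    assume "\<not> d - 1 \<le> k"
    then have "k < d - 1" by simp
    then have "a i = 0" for i
      using AR_low_degree[OF a(1) a(2)[rule_format]] by blast
    then show False using a(3) by simp
  qed
qed

section \<open>Dimension counts for the syzygies and the Jacobian ideal\<close>

lemma linear_dot:
  "Vector_Spaces.linear (\<lambda>c (b :: 3 \<Rightarrow> 3 cpoly) i. cst c * b i) (\<lambda>c (p :: 3 cpoly). cst c * p) (\<lambda>b. \<Sum>i\<in>UNIV. b i * g i)"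
  by unfold_locales (simp_all add: sum.distrib algebra_simps sum_distrib_left)

lemma subspace_dot_kernel:
  "cvec.subspace ({b. (\<Sum>i\<in>UNIV. b i * g i) = (0 :: 3 cpoly)} \<inter> form_vecs k)"
proof -
  interpret L: Vector_Spaces.linear "\<lambda>c (b :: 3 \<Rightarrow> 3 cpoly) i. cst c * b i" "\<lambda>c (p :: 3 cpoly). cst c * p"
    "\<lambda>b. \<Sum>i\<in>UNIV. b i * g i" by (rule linear_dot)
  show ?thesis by (intro cvec.subspace_inter L.subspace_kernel subspace_form_vecs)
qed

text \<open>The map is onto: by Euler's formula a form is the image of its gradient divided by its
  degree.\<close>

lemma dim_Koszul_kernel:
  "3 * ((k + 2) choose 2) =
     cvec.dim ({b. (\<Sum>i\<in>UNIV. b i * X i) = (0 :: 3 cpoly)} \<inter> form_vecs k) + ((k + 1 + 2) choose 2)"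
proof -
  let ?h = "\<lambda>b :: 3 \<Rightarrow> 3 cpoly. \<Sum>i\<in>UNIV. b i * X i"
  interpret L: Vector_Spaces.linear "\<lambda>c (b :: 3 \<Rightarrow> 3 cpoly) i. cst c * b i" "\<lambda>c (p :: 3 cpoly). cst c * p" ?h
    by (rule linear_dot)
  have "?h ` form_vecs k = forms (k + 1)"
  proof (intro equalityI subsetI)
    fix p assume "p \<in> ?h ` form_vecs k"
    then show "p \<in> forms (k + 1)"
      by (auto simp: mult.commute[of _ "X _"] intro!: homogeneous_sum homogeneous_X_mult)
  next
    fix p :: "3 cpoly" assume "p \<in> forms (k + 1)"
    then have p: "homogeneous (k + 1) p" by simp
    let ?t = "cst (1 / of_nat (k + 1)) :: 3 cpoly"
    have "?h (\<lambda>i. ?t * pdiff i p) = ?t * (\<Sum>i\<in>UNIV. X i * pdiff i p)"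
      by (simp add: sum_distrib_left mult_ac)
    also have "\<dots> = (?t * cst (of_nat (k + 1))) * p"
      by (simp only: euler[OF p] cst_of_nat mult.assoc)
    also have "?t * cst (of_nat (k + 1)) = 1"
      unfolding cst_mult[symmetric] by (simp del: of_nat_Suc of_nat_add)
    finally have "p = ?h (\<lambda>i. ?t * pdiff i p)" by simp
    moreover have "(\<lambda>i. ?t * pdiff i p) \<in> form_vecs k"
      using homogeneous_pdiff[OF p] by (auto intro: homogeneous_scale)
    ultimately show "p \<in> ?h ` form_vecs k" by (rule image_eqI)
  qed
  moreover have "{b \<in> form_vecs k. ?h b = 0} = {b. ?h b = 0} \<inter> form_vecs k"
    by auto
  ultimately show ?thesis
    using L.dim_kernel_image[OF subspace_form_vecs fin_dim_form_vecs, of k] by (simp add: dim_form_vecs dim_forms)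
qed

lemma subspace_AR: "cvec.subspace (AR f \<inter> form_vecs k)"
  unfolding AR_def by (rule subspace_dot_kernel)

lemma fin_dim_AR: "cvec.fin_dim (AR f \<inter> form_vecs k)"
  using cvec.fin_dim_subset[OF _ fin_dim_form_vecs[of k]] by auto

lemma linear_cross_X: "Vector_Spaces.linear (\<lambda>c (b :: 3 \<Rightarrow> 3 cpoly) i. cst c * b i) (\<lambda>c (b :: 3 \<Rightarrow> 3 cpoly) i. cst c * b i) (cross X)"
  by unfold_locales (auto simp: fun_eq_iff cross_def algebra_simps)

text \<open>A syzygy is sent to component \<open>l\<close> of its cross product along the curve. The
  image consists of multiples of \<open>G l\<close> by polynomials \<rho> of degree at most
  \<open>d * (n + 2)\<close>; the kernel embeds into the relations among the variables in degree
  \<open>n + 1\<close>.\<close>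

lemma dim_AR_le:
  "cvec.dim (AR f \<inter> form_vecs (n + d)) + ((n + 1 + 1 + 2) choose 2) \<le> d * (n + 2) + 1 + 3 * ((n + 1 + 2) choose 2)"
proof -
  let ?B = "{b. (\<Sum>i\<in>UNIV. b i * X i) = (0 :: 3 cpoly)} \<inter> form_vecs (n + 1)"
  let ?K = "{a \<in> AR f \<inter> form_vecs (n + d). \<forall>i. ev (cross X a i) = 0}"
  interpret C: Vector_Spaces.linear "\<lambda>c (b :: 3 \<Rightarrow> 3 cpoly) i. cst c * b i" "\<lambda>c (b :: 3 \<Rightarrow> 3 cpoly) i. cst c * b i" "cross X"
    by (rule linear_cross_X)
  interpret F: Vector_Spaces.linear "\<lambda>c (b :: 3 \<Rightarrow> 3 cpoly) i. cst c * b i" "\<lambda>c (b :: 3 \<Rightarrow> 3 cpoly) i. cst c * b i" "\<lambda>b i. f * b i"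
    by unfold_locales (auto simp: fun_eq_iff algebra_simps)
  interpret M: Vector_Spaces.linear smult smult "\<lambda>p. p * G l"
    by unfold_locales (simp_all add: algebra_simps)
  interpret L: Vector_Spaces.linear "\<lambda>c (b :: 3 \<Rightarrow> 3 cpoly) i. cst c * b i" smult "\<lambda>a. ev (cross X a l)"
    by unfold_locales (auto simp: cross_def algebra_simps smult_diff_right)
  have subB: "cvec.subspace ?B"
    by (rule subspace_dot_kernel)
  have finB: "cvec.fin_dim ?B"
    by (rule cvec.fin_dim_subset[OF _ fin_dim_form_vecs[of "n + 1"]]) auto
  have finFB: "cvec.fin_dim ((\<lambda>b i. f * b i) ` ?B)"
    by (rule F.fin_dim_image[OF finB])
  have finK: "cvec.fin_dim ?K"
    by (rule cvec.fin_dim_subset[OF _ fin_dim_AR[of "n + d"]]) auto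
  have subK: "cvec.subspace ?K"
    using subspace_AR[of "n + d"]
    by (auto simp: cvec.subspace_def C.add C.scale)
  \<comment> \<open>Every component of the cross product vanishes on the curve, so \<open>f\<close>
    divides it; contraction with the position vector shows that the cofactors form a relation among
    the variables.\<close>
  have "cross X a \<in> (\<lambda>b i. f * b i) ` ?B" if a: "a \<in> ?K" for a
  proof -
    have "\<forall>i. \<exists>b. homogeneous (n + 1) b \<and> cross X a i = f * b"
    proof
      fix i
      have "homogeneous (n + 1 + d) (cross X a i)"
        using homogeneous_cross_X[of "n + d" a i] a by simp
      moreover have "ev (cross X a i) = 0" using a by simp
      ultimately show "\<exists>b. homogeneous (n + 1) b \<and> cross X a i = f * b"
        by (rule ev_eq_0E) blast
    qed
    then obtain b where b: "\<And>i. homogeneous (n + 1) (b i)" "\<And>i. cross X a i = f * b i"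
      by metis
    have "f * (\<Sum>i\<in>UNIV. b i * X i) = (\<Sum>i\<in>UNIV. X i * cross X a i)"
      by (simp add: b sum_distrib_left mult_ac)
    then have "(\<Sum>i\<in>UNIV. b i * X i) = 0"
      using f(2) by (simp add: sum_mult_cross)
    moreover have "cross X a = (\<lambda>i. f * b i)" using b(2) by (rule ext)
    ultimately show ?thesis using b(1) by blast
  qed
  then have "cvec.dim ?K \<le> cvec.dim ((\<lambda>b i. f * b i) ` ?B)"
  proof (intro C.dim_le_of_inj subK finK finFB)
    fix a assume "a \<in> ?K" "cross X a = 0"
    then show "a = 0"
      using AR_homogeneous_eq_0[OF f(1) f(2) _, of a] d by (auto simp: fun_eq_iff)
  qed auto
  also have "\<dots> \<le> cvec.dim ?B"
    by (rule F.dim_image_le[OF subB finB])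
  finally have K: "cvec.dim ?K \<le> cvec.dim ?B" .
  let ?D = "{p :: complex poly. degree p \<le> d * (n + 2)}"
  have "cvec.dim (AR f \<inter> form_vecs (n + d)) \<le> cvec.dim ?K + upoly.dim ((\<lambda>p. p * G l) ` ?D)"
  proof (intro L.dim_le_kernel_image subspace_AR fin_dim_AR finK M.fin_dim_image fin_dim_degree_le)
    fix a assume a: "a \<in> AR f \<inter> form_vecs (n + d)" "ev (cross X a l) = 0"
    \<comment> \<open>One vanishing component is enough: \<open>G l\<close> is non-zero, hence
      \<rho> is 0 and all components vanish.\<close>
    then obtain \<rho> where "\<And>i. ev (cross X a i) = \<rho> * G i"
      using syzygy_multiple_of_gradient[of a "n + d"] by blast
    with a G_l(1) show "a \<in> ?K" by auto
  next
    show "(\<lambda>a. ev (cross X a l)) ` (AR f \<inter> form_vecs (n + d)) \<subseteq> (\<lambda>p. p * G l) ` ?D"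
    proof clarify
      fix a assume a: "a \<in> AR f" "\<forall>i. homogeneous (n + d) (a i)"
      obtain \<rho> where \<rho>: "\<And>i. ev (cross X a i) = \<rho> * G i"
        "\<rho> = 0 \<or> degree \<rho> + d * (d - 1) \<le> d * (n + d + 1)"
        using syzygy_multiple_of_gradient[OF a(1)] a(2) by blast
      have "n + d + 1 = (n + 2) + (d - 1)"
        using d by simp
      then have "d * (n + d + 1) = d * (n + 2) + d * (d - 1)"
        by (simp only: distrib_left)
      then have "degree \<rho> \<le> d * (n + 2)" using \<rho>(2) by auto
      with \<rho>(1) show "ev (cross X a l) \<in> (\<lambda>p. p * G l) ` ?D" by blast
    qed
  qed
  also have "upoly.dim ((\<lambda>p. p * G l) ` ?D) \<le> d * (n + 2) + 1"
    using M.dim_image_le[OF subspace_degree_le fin_dim_degree_le] by (simp add: dim_degree_le)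
  finally show ?thesis
    using K dim_Koszul_kernel[of "n + 1"] by linarith
qed

abbreviation jac_forms :: "nat \<Rightarrow> 3 cpoly set" where
  "jac_forms k \<equiv> jacobian_ideal f \<inter> forms k"

lemma dim_AR_jac:
  "3 * ((k + 2) choose 2) = cvec.dim (AR f \<inter> form_vecs k) + cpoly.dim (jac_forms (k + (d - 1)))"
proof -
  let ?h = "\<lambda>a :: 3 \<Rightarrow> 3 cpoly. \<Sum>i\<in>UNIV. a i * pdiff i f"
  interpret L: Vector_Spaces.linear "\<lambda>c (b :: 3 \<Rightarrow> 3 cpoly) i. cst c * b i" "\<lambda>c (p :: 3 cpoly). cst c * p" ?h
    by (rule linear_dot)
  note df = homogeneous_pdiff[OF f(1)]
  have "?h ` form_vecs k = jac_forms (k + (d - 1))"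
  proof (intro equalityI subsetI)
    fix p assume "p \<in> ?h ` form_vecs k"
    then show "p \<in> jac_forms (k + (d - 1))"
      using df by (auto simp: jacobian_ideal_def intro!: homogeneous_sum homogeneous_mult)
  next
    fix p assume "p \<in> jac_forms (k + (d - 1))"
    then obtain a where a: "p = ?h a" and p: "homogeneous (k + (d - 1)) p"
      by (auto simp: jacobian_ideal_def)
    \<comment> \<open>Arbitrary coefficients are replaced by their components of degree
      \<open>k\<close>, which represent the same form.\<close>
    have "p = hcomp (k + (d - 1)) (?h a)"
      unfolding a[symmetric] by (simp add: hcomp_homogeneous[OF p])
    also have "\<dots> = (\<Sum>i\<in>UNIV. hcomp (k + (d - 1)) (pdiff i f * a i))"
      by (simp only: hcomp_sum mult.commute)
    also have "\<dots> = (\<Sum>i\<in>UNIV. pdiff i f * hcomp k (a i))"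
      by (simp only: hcomp_mult_left[OF df]) simp
    also have "\<dots> = ?h (\<lambda>i. hcomp k (a i))"
      by (simp only: mult.commute)
    finally show "p \<in> ?h ` form_vecs k" by (rule image_eqI[where x = "\<lambda>i. hcomp k (a i)"]) simp
  qed
  moreover have "{a \<in> form_vecs k. ?h a = 0} = AR f \<inter> form_vecs k"
    by (auto simp: AR_def)
  ultimately show ?thesis
    using L.dim_kernel_image[OF subspace_form_vecs fin_dim_form_vecs, of k] by (simp add: dim_form_vecs)
qed

text \<open>The kernel of \<open>ev\<close> contributes the multiples of \<open>f\<close>. The image
  lies among the multiples of \<Delta> of degree at most \<open>d * (k + d)\<close>, which costs at
  least (d-1)(d-2) dimensions.\<close>

lemma dim_jac_le:
  "cpoly.dim (jac_forms (k + d)) + (d - 1) * (d - 2) \<le> ((k + 2) choose 2) + d * (k + d) + 1"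
proof -
  obtain \<Delta> N b where \<Delta>: "\<Delta> \<noteq> 0" and N: "\<And>i. G i = \<Delta> * N i"
    and deg: "(d - 1) * (d - 2) \<le> degree \<Delta>" "degree \<Delta> \<le> d * (d - 1)"
    using gradient_factor by metis
  interpret L: Vector_Spaces.linear "\<lambda>c (p :: 3 cpoly). cst c * p" smult ev by (rule linear_ev)
  interpret M: Vector_Spaces.linear smult smult "\<lambda>p. \<Delta> * p"
    by unfold_locales (simp_all add: algebra_simps)
  let ?D = "{p :: complex poly. degree p \<le> d * (k + d) - degree \<Delta>}"
  have "d * (d - 1) \<le> d * (k + d)"
    by (intro mult_left_mono) auto
  then have le: "degree \<Delta> \<le> d * (k + d)"
    using deg(2) by linarith
  have sub: "cpoly.subspace (jac_forms (k + d))"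
  proof (rule cpoly.subspace_inter[OF _ subspace_forms])
    show "cpoly.subspace (jacobian_ideal f)"
      unfolding cpoly.subspace_def jacobian_ideal_def
    proof safe
      show "\<exists>a. 0 = (\<Sum>i\<in>UNIV. a i * pdiff i f) \<and> True"
        by (rule exI[of _ "\<lambda>_. 0"]) simp
      fix a a' :: "3 \<Rightarrow> 3 cpoly" and t
      show "\<exists>b. (\<Sum>i\<in>UNIV. a i * pdiff i f) + (\<Sum>i\<in>UNIV. a' i * pdiff i f) = (\<Sum>i\<in>UNIV. b i * pdiff i f) \<and> True"
        by (rule exI[of _ "\<lambda>i. a i + a' i"]) (simp add: sum.distrib algebra_simps)
      show "\<exists>b. cst t * (\<Sum>i\<in>UNIV. a i * pdiff i f) = (\<Sum>i\<in>UNIV. b i * pdiff i f) \<and> True"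
        by (rule exI[of _ "\<lambda>i. cst t * a i"]) (simp add: sum_distrib_left mult.assoc)
    qed
  qed
  have "cpoly.dim (jac_forms (k + d)) \<le> cpoly.dim ((\<lambda>p. f * p) ` forms k) + upoly.dim ((\<lambda>p. \<Delta> * p) ` ?D)"
  proof (intro L.dim_le_kernel_image sub fin_dim_ideal M.fin_dim_image fin_dim_degree_le)
    show "cpoly.fin_dim (jac_forms (k + d))"
      by (rule cpoly.fin_dim_subset[OF _ fin_dim_forms[of "k + d"]]) auto
    fix P assume "P \<in> jac_forms (k + d)" "ev P = 0"
    then obtain Q where "homogeneous k Q" "P = f * Q"
      using ev_eq_0E by blast
    then show "P \<in> (\<lambda>p. f * p) ` forms k" by blast
  next
    show "ev ` jac_forms (k + d) \<subseteq> (\<lambda>p. \<Delta> * p) ` ?D"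
    proof clarify
      fix P assume P: "P \<in> jacobian_ideal f" "homogeneous (k + d) P"
      then obtain a where a: "P = (\<Sum>i\<in>UNIV. a i * pdiff i f)"
        by (auto simp: jacobian_ideal_def)
      define q where "q = (\<Sum>i\<in>UNIV. ev (a i) * N i)"
      have "ev P = (\<Sum>i\<in>UNIV. ev (a i) * G i)"
        by (simp add: a G_def)
      then have q: "ev P = \<Delta> * q"
        by (simp add: N q_def sum_distrib_left mult_ac)
      have "degree (ev P) \<le> d * (k + d)"
        using degree_ev[OF P(2)] by (simp add: m_eq_d)
      then have "degree q \<le> d * (k + d) - degree \<Delta>"
        using \<Delta> unfolding q by (cases "q = 0") (auto simp: degree_mult_eq)
      with q show "ev P \<in> (\<lambda>p. \<Delta> * p) ` ?D" by blast
    qed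
  qed
  also have "upoly.dim ((\<lambda>p. \<Delta> * p) ` ?D) \<le> d * (k + d) - degree \<Delta> + 1"
    using M.dim_image_le[OF subspace_degree_le fin_dim_degree_le] by (simp add: dim_degree_le)
  finally show ?thesis
    using deg(1) le unfolding dim_ideal by linarith
qed

text \<open>The bound on syzygies becomes a lower bound for the Jacobian ideal through
  \<open>dim_AR_jac\<close>, and \<open>dim_jac_le\<close> is an upper bound; both evaluate to the
  same number.\<close>

lemma milnor_hilbert_eq:
  assumes "2 * d \<le> k + 1"
  shows "2 * int (milnor_hilbert f k) = (int d - 1) * (int d - 2)"
proof -
  obtain n where n: "k + 1 = n + 2 * d"
    using assms by (metis add.commute le_Suc_ex)
  obtain d' where d': "d = d' + 2"
    using d by (metis add.commute le_Suc_ex)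
  \<comment> \<open>The same degree is read in two ways: as a syzygy degree shifted by the degree of
    the partial derivatives, and as a cofactor degree shifted by the degree of
    \<open>f\<close>.\<close>
  have k1: "k = (n + d) + (d - 1)" and k2: "k = (n + d') + 1 + d"
    using n d' by simp_all
  define J where "J = cpoly.dim (jac_forms k)"
  have J1: "3 * ((n + d + 2) choose 2) = cvec.dim (AR f \<inter> form_vecs (n + d)) + J"
    using dim_AR_jac[of "n + d"] by (simp only: k1 J_def)
  have "J + (d - 1) * (d - 2) \<le> ((n + d' + 1 + 2) choose 2) + d * (n + d' + 1 + d) + 1"
    using dim_jac_le[of "n + d' + 1"] by (simp only: k2 J_def)
  then have J2: "J + (d' + 1) * d' \<le> ((n + d' + 1 + 2) choose 2) + d * k + 1"
    by (simp add: k2 d')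
  \<comment> \<open>Makes the subtraction of natural numbers in \<open>milnor_hilbert\<close>
    exact.\<close>
  have mono: "J \<le> (k + 2) choose 2"
    unfolding dim_forms[symmetric] J_def by (intro cpoly.dim_mono fin_dim_forms) auto
  have H: "int (milnor_hilbert f k) = int ((k + 2) choose 2) - int J"
    using mono by (simp add: milnor_hilbert_def dim_forms J_def)
  have A: "int (cvec.dim (AR f \<inter> form_vecs (n + d))) + int ((n + 1 + 1 + 2) choose 2) \<le>
      int d * (int n + 2) + 1 + 3 * int ((n + 1 + 2) choose 2)"
    using of_nat_mono[OF dim_AR_le[of n], where 'a = int]
    by (simp only: of_nat_add of_nat_mult of_nat_numeral of_nat_1)
  have B: "3 * int ((n + d + 2) choose 2) = int (cvec.dim (AR f \<inter> form_vecs (n + d))) + int J"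
    using arg_cong[OF J1, of int] by (simp only: of_nat_add of_nat_mult of_nat_numeral)
  have C: "int J + (int d' + 1) * int d' \<le> int ((n + d' + 1 + 2) choose 2) + int d * int k + 1"
    using of_nat_mono[OF J2, where 'a = int] by (simp only: of_nat_add of_nat_mult of_nat_1)
  have K: "int k = int n + 2 * int d' + 3" "int d = int d' + 2"
    using n d' by simp_all
  note ch = double_choose_2[of k] double_choose_2[of "n + 1 + 1"] double_choose_2[of "n + 1"]
    double_choose_2[of "n + d"] double_choose_2[of "n + d' + 1"]
  have "2 * (int ((k + 2) choose 2) - int J) \<le> (int d' + 1) * int d'"
    using A B ch(1-4) unfolding K of_nat_add by (simp add: algebra_simps)
  moreover have "(int d' + 1) * int d' \<le> 2 * (int ((k + 2) choose 2) - int J)"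
    using C ch(1,5) unfolding K of_nat_add by (simp add: algebra_simps)
  ultimately show ?thesis
    unfolding H K by (simp add: algebra_simps)
qed

lemma global_tjurina_eq: "2 * int (global_tjurina f) = (int d - 1) * (int d - 2)"
proof -
  let ?t = "milnor_hilbert f (2 * d)"
  have "milnor_hilbert f k = ?t" if "2 * d \<le> k" for k
    using milnor_hilbert_eq[of k] milnor_hilbert_eq[of "2 * d"] that by simp
  then have ev: "\<forall>\<^sub>F k in sequentially. milnor_hilbert f k = ?t"
    using eventually_sequentially by blast
  have "global_tjurina f = ?t"
    unfolding global_tjurina_def
  proof (rule the_equality[where P = "\<lambda>t. \<forall>\<^sub>F k in sequentially. milnor_hilbert f k = t", OF ev])
    fix t assume "\<forall>\<^sub>F k in sequentially. milnor_hilbert f k = t"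
    with ev have "\<forall>\<^sub>F k in sequentially. t = ?t"
      by eventually_elim simp
    then show "t = ?t" by simp
  qed
  then show ?thesis
    using milnor_hilbert_eq[of "2 * d"] by simp
qed

text \<open>For r = d - 1 the first summand vanishes and the binomial is
  \<open>d choose 2\<close>.\<close>

lemma tau_max_eq: "2 * tau_max d (d - 1) = (int d - 1) * (int d - 2)"
proof -
  obtain n where n: "d = n + 2"
    using d by (metis add.commute le_Suc_ex)
  have "2 * (d - 1) + 2 - d = n + 2" using n by simp
  then show ?thesis
    using double_choose_2[of n] unfolding tau_max_def by (simp add: n power2_eq_square algebra_simps)
qed

lemma maximal_tjurina: "squarefree f \<Longrightarrow> maximal_tjurina_curve d (d - 1) f"
  unfolding maximal_tjurina_curve_def
  using d f mdr_eq global_tjurina_eq tau_max_eq by auto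

end

theorem proposition4p8:
  fixes f :: "3 cpoly" and d :: nat
  assumes "d \<ge> 2" and "maximal_nodal_curve d f"
  shows "maximal_tjurina_curve d (d - 1) f"
proof -
  have curve: "homogeneous d f" "irreducible f" "rational_curve f" "nodal f"
    using assms(2) by (auto simp: maximal_nodal_curve_def)
  show ?thesis
  proof (rule rational_curve_parametrization[OF curve(1) assms(1) curve(2,3)])
    fix u c :: "3 \<Rightarrow> complex poly" and m l and \<psi> :: "2 \<Rightarrow> 3 cpoly" and e \<mu> a
    assume *: "\<And>P k. homogeneous k P \<Longrightarrow> insertion (\<lambda>c. [:c:]) u P = 0 \<Longrightarrow> f dvd P"
      "insertion (\<lambda>c. [:c:]) u f = 0" "(\<Sum>i\<in>UNIV. c i * u i) = 1" "\<And>i. degree (u i) \<le> m"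
      "insertion (\<lambda>c. [:c:]) u (pdiff l f) \<noteq> 0"
      "degree (insertion (\<lambda>c. [:c:]) u (pdiff l f)) = m * (d - 1)" "\<And>j. homogeneous e (\<psi> j)"
      "insertion (\<lambda>c. [:c:]) u (\<psi> 0) = \<mu> * [:1, a:]"
      "insertion (\<lambda>c. [:c:]) u (\<psi> 1) = \<mu> * [:0, 1:]" "\<mu> \<noteq> 0"
    have "f \<noteq> 0" using curve(2) by auto
    interpret rational_nodal_curve f d m e u c \<psi> \<mu> a l
      by unfold_locales (use assms(1) curve(1,4) \<open>f \<noteq> 0\<close> * in blast)+
    show ?thesis
      by (rule maximal_tjurina[OF irreducible_imp_squarefree[OF curve(2)]])
  qed
qed

end
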